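(* Let $n\ge 3$. There exist a bounded domain $\Omega\subset\mathbb{R}^n$, a point $x_0\in\Omega$ and a constant $C>0$ such that $$k_\Omega(x,x_0)\le C\,d(x,\partial\Omega)^{-\frac1n}\log\frac{C}{d(x,\partial\Omega)}\quad\text{for all } x\in\Omega,$$ and a quasiconformal mapping $f:\Omega'\to\Omega$ (a homeomorphism onto $\Omega$), where $\Omega'\subset\mathbb{R}^n$ is a domain, such that $f$ is not uniformly continuous with respect to the Euclidean metric $d(x,y)=|x-y|$ in $\Omega$ and the internal metric $d_I$ in $\Omega'$; that is, $f:(\Omega',d_I)\to(\Omega,|\cdot|)$ is not uniformly continuous.
   Context: A domain is a nonempty open connected set, and $d(x,\partial\Omega)$ is the Euclidean distance from $x$ to the boundary. The quasihyperbolic distance in $\Omega$ is $$k_\Omega(x,x_0)=\inf_{\gamma_x}\int_{\gamma_x}\frac{ds}{d(z,\partial\Omega)},$$ the infimum being taken over all rectifiable curves $\gamma_x$ in $\Omega$ joining $x$ to $x_0$. For a domain $G\subset\mathbb{R}^n$ and $z,w\in G$, the internal distance $d_I(z,w)$ is the infimum of the lengths of all paths that join $z$ to $w$ in $G$. A quasiconformal mapping is a homeomorphism between domains that is $K$-quasiconformal for some $K\ge1$ in the usual sense. *)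

theory Defs
  imports "HOL-Analysis.Analysis"
begin

definition is_domain :: "'a::euclidean_space set \<Rightarrow> bool" where
  "is_domain G \<longleftrightarrow> G \<noteq> {} \<and> open G \<and> connected G"

(* This is the Euclidean distance only when the frontier is nonempty (G not the whole space):
   infdist to the empty set is 0. *)
definition bdist :: "'a::euclidean_space set \<Rightarrow> 'a \<Rightarrow> real" where
  "bdist G x = infdist x (frontier G)"


section \<open>Length and line integrals\<close>

(* The pieces of a division are nonempty closed intervals with disjoint interiors, so the sums
   are the lengths of the inscribed polygons. *)
definition curve_length :: "(real \<Rightarrow> 'a::euclidean_space) \<Rightarrow> real \<Rightarrow> real \<Rightarrow> ennreal" where
  "curve_length g a b =
     (SUP \<D>\<in>{\<D>. \<D> division_of {a..b}}. \<Sum>I\<in>\<D>. ennreal (dist (g (Inf I)) (g (Sup I))))"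

definition path_length :: "(real \<Rightarrow> 'a::euclidean_space) \<Rightarrow> ennreal" where
  "path_length g = curve_length g 0 1"

definition rectifiable_path :: "(real \<Rightarrow> 'a::euclidean_space) \<Rightarrow> bool" where
  "rectifiable_path g \<longleftrightarrow> path g \<and> path_length g < \<infinity>"

(* The arc length parametrisation of a rectifiable path g, defined on {0..path_length g}.
   The choice is harmless: g is constant between two parameters with the same arc length. *)
definition arc_param :: "(real \<Rightarrow> 'a::euclidean_space) \<Rightarrow> real \<Rightarrow> 'a" where
  "arc_param g s = g (SOME t. t \<in> {0..1} \<and> curve_length g 0 t = ennreal s)"

(* Integral with respect to arc length, for rectifiable g. *)
definition line_integral :: "('a::euclidean_space \<Rightarrow> ennreal) \<Rightarrow> (real \<Rightarrow> 'a) \<Rightarrow> ennreal" where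
  "line_integral \<rho> g = (\<integral>\<^sup>+ s\<in>{0..enn2real (path_length g)}. \<rho> (arc_param g s) \<partial>lborel)"


section \<open>Quasihyperbolic and internal distance\<close>

definition quasihyperbolic_dist :: "'a::euclidean_space set \<Rightarrow> 'a \<Rightarrow> 'a \<Rightarrow> ennreal" where
  "quasihyperbolic_dist G x y =
     (INF g\<in>{g. rectifiable_path g \<and> path_image g \<subseteq> G \<and> pathstart g = x \<and> pathfinish g = y}.
        line_integral (\<lambda>z. ennreal (1 / bdist G z)) g)"

definition internal_dist :: "'a::euclidean_space set \<Rightarrow> 'a \<Rightarrow> 'a \<Rightarrow> ennreal" where
  "internal_dist G z w =
     (INF g\<in>{g. path g \<and> path_image g \<subseteq> G \<and> pathstart g = z \<and> pathfinish g = w}. path_length g)"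

definition internally_uniformly_continuous ::
  "'a::euclidean_space set \<Rightarrow> ('a \<Rightarrow> 'b::metric_space) \<Rightarrow> bool" where
  "internally_uniformly_continuous G f \<longleftrightarrow>
     (\<forall>\<epsilon>>0. \<exists>\<delta>>0. \<forall>z\<in>G. \<forall>w\<in>G. internal_dist G z w < ennreal \<delta> \<longrightarrow> dist (f z) (f w) < \<epsilon>)"


section \<open>Quasiconformal mappings\<close>

definition abs_continuous_on_interval :: "(real \<Rightarrow> 'a::euclidean_space) \<Rightarrow> real \<Rightarrow> real \<Rightarrow> bool" where
  "abs_continuous_on_interval h a b \<longleftrightarrow>
     (\<forall>\<epsilon>>0. \<exists>\<delta>>0. \<forall>\<D> S. \<D> division_of S \<and> S \<subseteq> {a..b} \<and> (\<Sum>I\<in>\<D>. Sup I - Inf I) < \<delta>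
        \<longrightarrow> (\<Sum>I\<in>\<D>. dist (h (Inf I)) (h (Sup I))) < \<epsilon>)"

(* Absolute continuity on almost every segment, parallel to a coordinate axis, of each closed box
   in G. The condition on x does not depend on the coordinate x $ i, which ranges over an interval;
   so, by Fubini, "for almost every x in the box" means "for almost every segment" in the sense of
   (n-1)-dimensional measure. *)
definition ACL_on :: "(real^'n::finite) set \<Rightarrow> (real^'n \<Rightarrow> real^'n) \<Rightarrow> bool" where
  "ACL_on G f \<longleftrightarrow> continuous_on G f \<and>
     (\<forall>a b i. cbox a b \<subseteq> G \<longrightarrow>
        (AE x in lebesgue. x \<in> cbox a b \<longrightarrow>
           abs_continuous_on_interval (\<lambda>t. f (\<chi> j. if j = i then t else x $ j)) (a $ i) (b $ i)))"

(* The analytic definition of a K-quasiconformal homeomorphism, with outer dilatation K. The local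
   n-integrability of the derivative need not be required: for a homeomorphism it follows from the
   dilatation inequality, since the Jacobian determinant is locally integrable. As usual the
   absolute value allows orientation-reversing maps. *)
definition K_quasiconformal ::
  "real \<Rightarrow> (real^'n::finite) set \<Rightarrow> (real^'n) set \<Rightarrow> (real^'n \<Rightarrow> real^'n) \<Rightarrow> bool" where
  "K_quasiconformal K G H f \<longleftrightarrow>
     is_domain G \<and> is_domain H \<and> (\<exists>g. homeomorphism G H f g) \<and> ACL_on G f \<and>
     (AE x in lebesgue. x \<in> G \<longrightarrow>
        (\<exists>D. (f has_derivative D) (at x) \<and> onorm D ^ CARD('n) \<le> K * \<bar>det (matrix D)\<bar>))"

definition quasiconformal ::
  "(real^'n::finite) set \<Rightarrow> (real^'n) set \<Rightarrow> (real^'n \<Rightarrow> real^'n) \<Rightarrow> bool" where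
  "quasiconformal G H f \<longleftrightarrow> (\<exists>K\<ge>1. K_quasiconformal K G H f)"

end

theory Submission
  imports Defs
begin

text \<open>
  \<open>\<Omega>\<close> consists of thin tubes (hubs) of length about 1, one for each level \<open>m\<close>, all parallel to the same
  axis and converging to a segment. Consecutive hubs are joined by \<open>J\<^sup>n\<^sup>-\<^sup>1 + 1\<close> equally spaced channels of
  width about \<open>J\<^sup>-\<^sup>n\<close>, where \<open>J = 2\<^sup>m\<^sup>+\<^sup>1\<close>. Travelling along a hub to the next channel costs
  quasihyperbolic length \<open>O(J)\<close>, and so does a channel, up to a logarithm, if its length is
  \<open>J\<^sup>1\<^sup>-\<^sup>n log J\<close>; this is the growth bound.

  The quasiconformal image \<open>\<Omega>'\<close> is obtained by shrinking the hub of level \<open>m\<close> by the factor \<open>2\<^sup>-\<^sup>m\<close>, so that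
  its two ends become close to each other in the internal metric. The channels have to run from a
  segment to a segment half as long, and yet they may not be thin for long, because the dilatation is
  bounded only if each of them keeps its quasihyperbolic length \<open>O(J log J)\<close>. Therefore they fan out into
  an \<open>(n-1)\<close>-dimensional array: the position along the segment gives one coordinate, and the \<open>n - 2\<close> lowest
  digits of the number of the channel in base \<open>J\<close> give the others. Two channels either differ in a
  digit, or they are at least \<open>J\<^sup>-\<^sup>1\<close> apart along the segment, hence all of them can widen up to about
  \<open>J\<^sup>-\<^sup>1\<close>. In the height \<open>s\<close> the map multiplies a cross-section by a scale \<open>\<sigma>(s)\<close> and translates it with
  speed \<open>O(\<sigma>)\<close>, while the height itself has derivative \<open>\<sigma>\<close>; so the derivative is \<open>\<sigma>\<close> times a bounded
  shear.
\<close>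

section \<open>Polygons and bounds for the quasihyperbolic distance\<close>

lemma division_of_real_cases:
  fixes a b :: real
  assumes "\<D> division_of {a..b}" "I \<in> \<D>"
  obtains c d where "I = {c..d}" "c \<le> d" "a \<le> c" "d \<le> b"
proof -
  obtain c d where "I = cbox c d" "I \<noteq> {}" "I \<subseteq> {a..b}"
    using division_ofD(2,3,4)[OF assms(1)] assms(2) by metis
  then show ?thesis using that[of c d] by auto
qed

text \<open>Each chord is at most \<open>L\<close> times the length of its piece, and the lengths of
  the pieces of a division add up to \<open>b - a\<close>.\<close>

lemma curve_length_Lipschitz:
  fixes g :: "real \<Rightarrow> 'a::euclidean_space"
  assumes L: "\<And>x y. a \<le> x \<Longrightarrow> x \<le> y \<Longrightarrow> y \<le> b \<Longrightarrow> dist (g x) (g y) \<le> L * (y - x)"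
    and "a \<le> b" "0 \<le> L"
  shows "curve_length g a b \<le> ennreal (L * (b - a))"
  unfolding curve_length_def
proof (rule SUP_least, clarify)
  fix \<D> assume D: "\<D> division_of {a..b}"
  have le: "dist (g (Inf I)) (g (Sup I)) \<le> L * measure lborel I" if I: "I \<in> \<D>" for I
  proof -
    obtain c d where "I = {c..d}" "c \<le> d" "a \<le> c" "d \<le> b"
      using division_of_real_cases[OF D I] by blast
    then show ?thesis using L[of c d] by simp
  qed
  have "(\<Sum>I\<in>\<D>. ennreal (dist (g (Inf I)) (g (Sup I)))) = ennreal (\<Sum>I\<in>\<D>. dist (g (Inf I)) (g (Sup I)))"
    by (simp add: sum_ennreal)
  also have "\<dots> \<le> ennreal (\<Sum>I\<in>\<D>. L * measure lborel I)"
    by (intro ennreal_leI sum_mono le)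
  also have "(\<Sum>I\<in>\<D>. L * measure lborel I) = L * (b - a)"
    using additive_content_division[of \<D> a b] D \<open>a \<le> b\<close> by (simp add: sum_distrib_left[symmetric])
  finally show "(\<Sum>I\<in>\<D>. ennreal (dist (g (Inf I)) (g (Sup I)))) \<le> ennreal (L * (b - a))" .
qed

lemma dist_le_curve_length:
  fixes g :: "real \<Rightarrow> 'a::euclidean_space"
  assumes "a \<le> b"
  shows "ennreal (dist (g a) (g b)) \<le> curve_length g a b"
proof -
  have "{{a..b}} division_of {a..b}"
    using division_of_self[of a b] assms by simp
  then have "(\<Sum>I\<in>{{a..b}}. ennreal (dist (g (Inf I)) (g (Sup I)))) \<le> curve_length g a b"
    unfolding curve_length_def by (intro SUP_upper) simp
  then show ?thesis using assms by simp
qed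

text \<open>A division of \<open>{a..b}\<close> and one of \<open>{b..c}\<close> combine into a
  division of \<open>{a..c}\<close>.\<close>

lemma curve_length_superadditive:
  fixes g :: "real \<Rightarrow> 'a::euclidean_space"
  assumes "a \<le> b" "b \<le> c"
  shows "curve_length g a b + curve_length g b c \<le> curve_length g a c"
proof -
  define F where "F = (\<lambda>\<D>. \<Sum>I\<in>\<D>. ennreal (dist (g (Inf I)) (g (Sup I))))"
  define DD where "DD = (\<lambda>a b::real. {\<D>. \<D> division_of {a..b}})"
  have ne: "DD a b \<noteq> {}" if "a \<le> b" for a b
  proof -
    have "{{a..b}} \<in> DD a b" using division_of_self[of a b] that by (simp add: DD_def)
    then show ?thesis by blast
  qed
  have cl: "curve_length g a b = (SUP \<D>\<in>DD a b. F \<D>)" for a b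
    by (simp add: curve_length_def F_def DD_def)
  have *: "F D1 + F D2 \<le> curve_length g a c" if "D1 \<in> DD a b" "D2 \<in> DD b c" for D1 D2
  proof -
    have D1: "D1 division_of {a..b}" and D2: "D2 division_of {b..c}" using that by (auto simp: DD_def)
    have "interior {a..b} \<inter> interior {b..c} = {}" by auto
    with D1 D2 have "D1 \<union> D2 division_of {a..b} \<union> {b..c}" by (rule division_disjoint_union)
    moreover have "{a..b} \<union> {b..c} = {a..c}" using assms by auto
    ultimately have U: "D1 \<union> D2 \<in> DD a c" by (simp add: DD_def)
    have fin: "finite D1" "finite D2" using D1 D2 by auto
    \<comment> \<open>The union counts a common piece only once. Such a piece lies on both sides of
      \<open>b\<close>, so it is a single point and its chord vanishes.\<close>
    have zero: "ennreal (dist (g (Inf I)) (g (Sup I))) = 0" if "I \<in> D1 \<inter> D2" for I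
    proof -
      have I: "I \<in> D1" "I \<in> D2" using that by auto
      obtain p q where pq: "I = {p..q}" "p \<le> q" "q \<le> b" using division_of_real_cases[OF D1 I(1)] by blast
      obtain p' q' where pq': "I = {p'..q'}" "p' \<le> q'" "b \<le> p'" using division_of_real_cases[OF D2 I(2)] by blast
      have "p = q" using pq pq' by auto
      then show ?thesis using pq by simp
    qed
    have "F D1 + F D2 = F (D1 \<union> D2) + F (D1 \<inter> D2)"
      unfolding F_def by (rule sum.union_inter[OF fin, symmetric])
    also have "F (D1 \<inter> D2) = 0" unfolding F_def using zero by (simp add: sum.neutral)
    finally show ?thesis unfolding cl using U by (auto intro: SUP_upper)
  qed
  have "curve_length g a b + curve_length g b c = (SUP D1\<in>DD a b. F D1 + curve_length g b c)"
    unfolding cl[of a b] using ne[OF assms(1)] by (simp add: ennreal_SUP_add_left)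
  also have "\<dots> \<le> curve_length g a c"
  proof (rule SUP_least)
    fix D1 assume D1: "D1 \<in> DD a b"
    have "F D1 + curve_length g b c = (SUP D2\<in>DD b c. F D1 + F D2)"
      unfolding cl[of b c] using ne[OF assms(2)] by (simp add: ennreal_SUP_add_right)
    also have "\<dots> \<le> curve_length g a c" using *[OF D1] by (auto intro: SUP_least)
    finally show "F D1 + curve_length g b c \<le> curve_length g a c" .
  qed
  finally show ?thesis .
qed

text \<open>\<open>S\<close> contains the parameters of the corners. Asking for exact distances
  between corners fixes the speed \<open>v\<close>, so that arc length is known without
  integration.\<close>

definition broken_line :: "real \<Rightarrow> real set \<Rightarrow> (real \<Rightarrow> 'a::metric_space) \<Rightarrow> real \<Rightarrow> bool" where
  "broken_line v S g l \<longleftrightarrow> (\<forall>a b. 0 \<le> a \<and> a \<le> b \<and> b \<le> l \<and> {a<..<b} \<inter> S = {} \<longrightarrow> dist (g a) (g b) = v * (b - a))"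

text \<open>Induction on the number of corners strictly between \<open>a\<close> and
  \<open>b\<close>: after splitting at a corner, the triangle inequality handles the chord and
  superadditivity the length.\<close>

lemma broken_line_length:
  fixes g :: "real \<Rightarrow> 'a::euclidean_space"
  assumes g: "broken_line v S g l" and S: "finite S" and v: "0 \<le> v" and ab: "0 \<le> a" "a \<le> b" "b \<le> l"
  shows "dist (g a) (g b) \<le> v * (b - a) \<and> ennreal (v * (b - a)) \<le> curve_length g a b"
  using ab
proof (induction "card (S \<inter> {a<..<b})" arbitrary: a b rule: less_induct)
  case less
  show ?case
  proof (cases "{a<..<b} \<inter> S = {}")
    case True
    then have "dist (g a) (g b) = v * (b - a)" using g less.prems by (simp add: broken_line_def)
    then show ?thesis using dist_le_curve_length[of a b g] less.prems by simp
  next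
    case False
    then obtain c where c: "c \<in> S" "a < c" "c < b" by auto
    have "card (S \<inter> {a<..<c}) < card (S \<inter> {a<..<b})" "card (S \<inter> {c<..<b}) < card (S \<inter> {a<..<b})"
      using S c by (auto intro!: psubset_card_mono)
    with less.hyps[of a c] less.hyps[of c b] less.prems c
    have 1: "dist (g a) (g c) \<le> v * (c - a)" "ennreal (v * (c - a)) \<le> curve_length g a c"
      and 2: "dist (g c) (g b) \<le> v * (b - c)" "ennreal (v * (b - c)) \<le> curve_length g c b" by auto
    have "dist (g a) (g b) \<le> v * (b - a)"
      using 1(1) 2(1) dist_triangle[of "g a" "g b" "g c"] by (simp add: algebra_simps)
    moreover have "ennreal (v * (b - a)) = ennreal (v * (c - a)) + ennreal (v * (b - c))"
      using v c by (subst ennreal_plus[symmetric]) (auto simp: right_diff_distrib intro!: mult_left_mono)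
    then have "ennreal (v * (b - a)) \<le> curve_length g a b"
      using add_mono[OF 1(2) 2(2)] curve_length_superadditive[of a c b g] c by simp
    ultimately show ?thesis by blast
  qed
qed

lemma broken_line_curve_length:
  fixes g :: "real \<Rightarrow> 'a::euclidean_space"
  assumes "broken_line v S g l" "finite S" "0 \<le> v" "0 \<le> a" "a \<le> b" "b \<le> l"
  shows "curve_length g a b = ennreal (v * (b - a))"
proof (rule antisym)
  show "curve_length g a b \<le> ennreal (v * (b - a))"
    by (rule curve_length_Lipschitz)
       (use assms broken_line_length[OF assms(1-3)] in auto)
  show "ennreal (v * (b - a)) \<le> curve_length g a b"
    using broken_line_length[OF assms] by blast
qed

text \<open>The bound \<open>c\<close> is witnessed by a unit speed polygon from \<open>x\<close> to \<open>y\<close>, so that appending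
  segments needs no reparametrisation; \<open>\<psi>\<close> is a majorant of the density along it.\<close>

definition qh_bound :: "'a::euclidean_space set \<Rightarrow> 'a \<Rightarrow> 'a \<Rightarrow> real \<Rightarrow> bool" where
  "qh_bound G x y c \<longleftrightarrow> (\<exists>l S g \<psi>. 0 \<le> l \<and> finite S \<and> broken_line 1 S g l \<and> g 0 = x \<and> g l = y \<and>
     g ` {0..l} \<subseteq> G \<and> \<psi> \<in> borel_measurable lborel \<and>
     (\<forall>s\<in>{0..l}. ennreal (1 / bdist G (g s)) \<le> \<psi> s) \<and> (\<integral>\<^sup>+s\<in>{0..l}. \<psi> s \<partial>lborel) \<le> ennreal c)"

lemma broken_line_continuous:
  fixes g :: "real \<Rightarrow> 'a::euclidean_space"
  assumes "broken_line v S g l" "finite S" "0 \<le> v"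
  shows "continuous_on {0..l} g"
proof (rule lipschitz_on_continuous_on)
  show "v-lipschitz_on {0..l} g"
  proof (rule lipschitz_onI)
    fix x y assume xy: "x \<in> {0..l}" "y \<in> {0..l}"
    show "dist (g x) (g y) \<le> v * dist x y"
    proof (cases "x \<le> y")
      case True
      then show ?thesis using broken_line_length[OF assms, of x y] xy by (simp add: dist_real_def)
    next
      case False
      then show ?thesis using broken_line_length[OF assms, of y x] xy
        by (simp add: dist_real_def dist_commute)
    qed
  qed fact
qed

lemma qh_bound_imp_path:
  assumes "qh_bound G x y c"
  shows "\<exists>g. path g \<and> path_image g \<subseteq> G \<and> pathstart g = x \<and> pathfinish g = y"
proof -
  obtain l S g where g: "0 \<le> l" "finite S" "broken_line 1 S g l" "g 0 = x" "g l = y" "g ` {0..l} \<subseteq> G"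
    using assms unfolding qh_bound_def by blast
  have im: "(\<lambda>t. l * t) ` {0..1} \<subseteq> {0..l}" using g(1) by (auto intro: mult_left_le)
  have "path (\<lambda>t. g (l * t))"
    unfolding path_def
    by (rule continuous_on_compose2[OF broken_line_continuous[OF g(3,2)]]) (use im in \<open>auto intro!: continuous_intros\<close>)
  moreover have "path_image (\<lambda>t. g (l * t)) \<subseteq> G" unfolding path_image_def using im g(6) by auto
  ultimately show ?thesis using g by (intro exI[of _ "\<lambda>t. g (l * t)"]) (auto simp: pathstart_def pathfinish_def)
qed

text \<open>Rescaled to \<open>[0,1]\<close>, the polygon is a rectifiable path of constant speed
  \<open>l\<close> whose arc length parametrisation is the original polygon; so the majorant bounds
  its line integral.\<close>

lemma qh_bound_imp_dist_le:
  fixes G :: "'a::euclidean_space set"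
  assumes "qh_bound G x y c"
  shows "quasihyperbolic_dist G x y \<le> ennreal c"
proof -
  obtain l S g \<psi> where g: "0 \<le> l" "finite S" "broken_line 1 S g l" "g 0 = x" "g l = y" "g ` {0..l} \<subseteq> G"
    and \<psi>: "\<And>s. s \<in> {0..l} \<Longrightarrow> ennreal (1 / bdist G (g s)) \<le> \<psi> s"
      "(\<integral>\<^sup>+s\<in>{0..l}. \<psi> s \<partial>lborel) \<le> ennreal c"
    using assms unfolding qh_bound_def by blast
  define h where "h = (\<lambda>t. g (l * t))"
  have im: "(\<lambda>t. l * t) ` {0..1} \<subseteq> {0..l}" using g(1) by (auto intro: mult_left_le)
  have path: "path h"
    unfolding path_def h_def
    by (rule continuous_on_compose2[OF broken_line_continuous[OF g(3,2)]]) (use im in \<open>auto intro!: continuous_intros\<close>)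
  have img: "path_image h \<subseteq> G" unfolding path_image_def h_def using im g(6) by auto
  have ends: "pathstart h = x" "pathfinish h = y" using g by (auto simp: h_def pathstart_def pathfinish_def)
  have len: "curve_length h a b = ennreal (l * (b - a))" if "0 \<le> a" "a \<le> b" "b \<le> 1" for a b
  proof (cases "l = 0")
    case True
    have "curve_length h a b \<le> ennreal (0 * (b - a))"
      by (rule curve_length_Lipschitz) (use that True in \<open>auto simp: h_def\<close>)
    then show ?thesis using True by simp
  next
    case False
    with g(1) have l: "l > 0" by simp
    have "broken_line l ((\<lambda>s. s / l) ` S) h 1"
      unfolding broken_line_def
    proof (intro allI impI)
      fix a b assume ab: "0 \<le> a \<and> a \<le> b \<and> b \<le> 1 \<and> {a<..<b} \<inter> (\<lambda>s. s / l) ` S = {}"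
      have "{l*a<..<l*b} \<inter> S = {}"
      proof (rule ccontr)
        assume "{l*a<..<l*b} \<inter> S \<noteq> {}"
        then obtain s where "s \<in> S" "l * a < s" "s < l * b" by auto
        then have "s / l \<in> {a<..<b} \<inter> (\<lambda>s. s / l) ` S" using l by (auto simp: field_simps)
        with ab show False by blast
      qed
      moreover have "0 \<le> l * a" "l * a \<le> l * b" "l * b \<le> l" using ab l by (auto intro: mult_left_le)
      ultimately have "dist (g (l*a)) (g (l*b)) = 1 * (l*b - l*a)" using g(3) unfolding broken_line_def by blast
      then show "dist (h a) (h b) = l * (b - a)" by (simp add: h_def algebra_simps)
    qed
    then show ?thesis using broken_line_curve_length[of l _ h 1 a b] that g l by auto
  qed
  have plen: "path_length h = ennreal l" unfolding path_length_def using len[of 0 1] by simp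
  have rect: "rectifiable_path h" unfolding rectifiable_path_def using path plen by simp
  have ap: "arc_param h s = g s" if "s \<in> {0..l}" "l > 0" for s
  proof -
    \<comment> \<open>The arc length up to \<open>t\<close> is \<open>l * t\<close>, which is
      injective in \<open>t\<close>, so the choice is forced.\<close>
    have "(SOME t. t \<in> {0..1} \<and> curve_length h 0 t = ennreal s) = s / l"
    proof (rule some_equality)
      show "s / l \<in> {0..1} \<and> curve_length h 0 (s / l) = ennreal s"
        using that len[of 0 "s/l"] by (auto simp: field_simps)
      fix t assume t: "t \<in> {0..1} \<and> curve_length h 0 t = ennreal s"
      then have "ennreal (l * t) = ennreal s" using len[of 0 t] by simp
      then have "l * t = s" using t that by simp
      then show "t = s / l" using that by auto
    qed
    then show ?thesis unfolding arc_param_def using that by (simp add: h_def)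
  qed
  have "line_integral (\<lambda>z. ennreal (1 / bdist G z)) h \<le> ennreal c"
  proof (cases "l = 0")
    case True
    have "line_integral (\<lambda>z. ennreal (1 / bdist G z)) h = 0"
    proof -
      have "(\<integral>\<^sup>+ s\<in>{0..0::real}. ennreal (1 / bdist G (arc_param h s)) \<partial>lborel) = integral\<^sup>N lborel (\<lambda>s::real. 0)"
      proof (rule nn_integral_cong_AE)
        have "AE s::real in lborel. s \<noteq> 0" by (rule AE_lborel_singleton)
        then show "AE s in lborel. ennreal (1 / bdist G (arc_param h s)) * indicator {0..0::real} s = 0"
          by eventually_elim (auto simp: indicator_def)
      qed
      then show ?thesis unfolding line_integral_def plen using True by simp
    qed
    then show ?thesis by simp
  next
    case False
    with g(1) have l: "l > 0" by simp
    have "line_integral (\<lambda>z. ennreal (1 / bdist G z)) h \<le> (\<integral>\<^sup>+s\<in>{0..l}. \<psi> s \<partial>lborel)"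
      unfolding line_integral_def plen
      by (rule nn_integral_mono) (use ap \<psi>(1) l in \<open>auto simp: indicator_def\<close>)
    also note \<psi>(2)
    finally show ?thesis .
  qed
  moreover have "quasihyperbolic_dist G x y \<le> line_integral (\<lambda>z. ennreal (1 / bdist G z)) h"
    unfolding quasihyperbolic_dist_def using path img ends rect by (intro INF_lower) auto
  ultimately show ?thesis by (rule order_trans[rotated])
qed

lemma qh_bound_mono: "qh_bound G x y c \<Longrightarrow> c \<le> c' \<Longrightarrow> qh_bound G x y c'"
  unfolding qh_bound_def by (elim exE conjE, intro exI conjI) (assumption | erule order_trans | rule ennreal_leI)+

text \<open>The segment is traversed at unit speed after the polygon; the density on it is at most
  \<open>1 / r\<close>.\<close>

lemma qh_bound_append:
  fixes G :: "'a::euclidean_space set"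
  assumes xy: "qh_bound G x y c" and c: "0 \<le> c" and r: "r > 0"
    and seg: "\<And>u. u \<in> closed_segment y z \<Longrightarrow> u \<in> G \<and> r \<le> bdist G u"
  shows "qh_bound G x z (c + dist y z / r)"
proof (cases "y = z")
  case True
  then show ?thesis using xy by simp
next
  case False
  obtain l S g \<psi> where g: "0 \<le> l" "finite S" "broken_line 1 S g l" "g 0 = x" "g l = y" "g ` {0..l} \<subseteq> G"
    and \<psi>m: "\<psi> \<in> borel_measurable lborel" and \<psi>: "\<And>s. s \<in> {0..l} \<Longrightarrow> ennreal (1 / bdist G (g s)) \<le> \<psi> s"
      "(\<integral>\<^sup>+s\<in>{0..l}. \<psi> s \<partial>lborel) \<le> ennreal c"
    using xy unfolding qh_bound_def by blast
  define p where "p = dist y z"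
  have p: "p > 0" using False by (simp add: p_def)
  define e where "e = (z - y) /\<^sub>R p"
  have ne: "norm e = 1" using p by (simp add: e_def p_def dist_norm norm_minus_commute)
  have pe: "p *\<^sub>R e = z - y" using p by (simp add: e_def)
  define g' where "g' = (\<lambda>s. if s \<le> l then g s else y + (s - l) *\<^sub>R e)"
  define \<psi>' where "\<psi>' = (\<lambda>s. if s \<le> l then \<psi> s else ennreal (1 / r))"
  have g'2: "g' s = y + (s - l) *\<^sub>R e" if "l \<le> s" for s using that g(5) by (auto simp: g'_def)
  have seg': "g' s \<in> closed_segment y z" if "s \<in> {l..l+p}" for s
  proof -
    have "y + (s - l) *\<^sub>R e = y + ((s - l) / p) *\<^sub>R (z - y)" using p by (simp add: pe[symmetric])
    then have "y + (s - l) *\<^sub>R e = (1 - (s - l) / p) *\<^sub>R y + ((s - l) / p) *\<^sub>R z" by (simp add: algebra_simps)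
    moreover have "0 \<le> (s - l) / p" "(s - l) / p \<le> 1" using that p by auto
    ultimately show ?thesis using that g'2[of s] by (auto simp: closed_segment_def)
  qed
  have "broken_line 1 (insert l S) g' (l + p)"
    unfolding broken_line_def
  proof (intro allI impI)
    fix a b assume ab: "0 \<le> a \<and> a \<le> b \<and> b \<le> l + p \<and> {a<..<b} \<inter> insert l S = {}"
    show "dist (g' a) (g' b) = 1 * (b - a)"
    proof (cases "b \<le> l")
      case True
      moreover have "{a<..<b} \<inter> S = {}" using ab by blast
      ultimately show ?thesis using g(3) ab unfolding broken_line_def g'_def by simp
    next
      case False
      then have "l \<le> a" using ab by auto
      then have "g' a = y + (a - l) *\<^sub>R e" "g' b = y + (b - l) *\<^sub>R e" using g'2 ab by auto
      then have "g' a - g' b = (a - l) *\<^sub>R e - (b - l) *\<^sub>R e" by simp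
      then have "g' a - g' b = (a - b) *\<^sub>R e" by (simp flip: scaleR_diff_left)
      then show ?thesis using ne ab by (simp add: dist_norm)
    qed
  qed
  moreover have "g' 0 = x" "g' (l + p) = z" using g p pe by (auto simp: g'_def)
  moreover have "g' ` {0..l+p} \<subseteq> G"
  proof (clarify)
    fix s assume s: "s \<in> {0..l+p}"
    show "g' s \<in> G"
    proof (cases "s \<le> l")
      case True then show ?thesis using g(6) s by (auto simp: g'_def)
    next
      case False then show ?thesis using seg seg'[of s] s by auto
    qed
  qed
  moreover have \<psi>'m: "\<psi>' \<in> borel_measurable lborel" unfolding \<psi>'_def using \<psi>m by measurable
  moreover have "ennreal (1 / bdist G (g' s)) \<le> \<psi>' s" if s: "s \<in> {0..l+p}" for s
  proof (cases "s \<le> l")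
    case True then show ?thesis using \<psi>(1)[of s] s by (auto simp: g'_def \<psi>'_def)
  next
    case False
    then have "r \<le> bdist G (g' s)" using seg seg'[of s] s by auto
    then show ?thesis using False r by (auto simp: \<psi>'_def intro!: ennreal_leI divide_left_mono)
  qed
  moreover have "(\<integral>\<^sup>+s\<in>{0..l+p}. \<psi>' s \<partial>lborel) \<le> ennreal (c + dist y z / r)"
  proof -
    have "(\<integral>\<^sup>+s\<in>{0..l+p}. \<psi>' s \<partial>lborel) \<le> (\<integral>\<^sup>+s. \<psi> s * indicator {0..l} s + ennreal (1 / r) * indicator {l..l+p} s \<partial>lborel)"
      by (rule nn_integral_mono) (auto simp: \<psi>'_def indicator_def)
    also have "\<dots> = (\<integral>\<^sup>+s\<in>{0..l}. \<psi> s \<partial>lborel) + (\<integral>\<^sup>+s. ennreal (1 / r) * indicator {l..l+p} s \<partial>lborel)"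
      using \<psi>m by (intro nn_integral_add) auto
    also have "(\<integral>\<^sup>+s. ennreal (1 / r) * indicator {l..l+p} s \<partial>lborel) = ennreal (p / r)"
      using p r by (subst nn_integral_cmult_indicator) (auto simp: ennreal_mult[symmetric])
    also have "(\<integral>\<^sup>+s\<in>{0..l}. \<psi> s \<partial>lborel) + ennreal (p / r) \<le> ennreal c + ennreal (p / r)"
      using \<psi>(2) by (rule add_right_mono)
    also have "\<dots> = ennreal (c + p / r)" using c p r by (simp add: ennreal_plus)
    finally show ?thesis by (simp add: p_def)
  qed
  ultimately show ?thesis unfolding qh_bound_def using g p
    by (intro exI[of _ "l + p"] exI[of _ "insert l S"] exI[of _ g'] exI[of _ \<psi>']) auto
qed

text \<open>Over the null set \<open>{0..0}\<close> even the majorant \<infinity> has integral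
  0.\<close>

lemma qh_bound_trivial: "x \<in> G \<Longrightarrow> qh_bound G x x 0"
  unfolding qh_bound_def broken_line_def
  by (intro exI[of _ 0] exI[of _ "{}"] exI[of _ "\<lambda>_. x"] exI[of _ "\<lambda>_. \<infinity>"])
     (auto simp: nn_integral_cmult_indicator)

section \<open>Estimates for the distance to the boundary\<close>

lemma bdist_le_dist:
  fixes G :: "'a::euclidean_space set"
  assumes "x \<in> G" "y \<notin> G"
  shows "bdist G x \<le> dist x y"
proof -
  have "closed_segment x y \<inter> frontier G \<noteq> {}"
    by (rule connected_Int_frontier) (use assms in auto)
  then obtain z where z: "z \<in> closed_segment x y" "z \<in> frontier G" by auto
  then have "bdist G x \<le> dist x z" unfolding bdist_def by (intro infdist_le)
  also have "\<dots> \<le> dist x y" using segment_bound(1)[OF z(1)] by (simp add: dist_norm norm_minus_commute)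
  finally show ?thesis .
qed

lemma bdist_Lipschitz:
  fixes G :: "'a::euclidean_space set"
  shows "bdist G x \<le> bdist G y + dist x y"
  unfolding bdist_def by (rule infdist_triangle)

lemma frontier_nonempty:
  fixes G :: "'a::euclidean_space set"
  assumes "bounded G" "G \<noteq> {}"
  shows "frontier G \<noteq> {}"
  using assms frontier_eq_empty not_bounded_UNIV by metis

text \<open>An open set contains no point of its frontier. Boundedness makes the frontier nonempty,
  so that \<open>infdist\<close> is a genuine infimum.\<close>

lemma bdist_ge:
  fixes G :: "'a::euclidean_space set"
  assumes "bounded G" "open G" "ball x r \<subseteq> G" "r > 0"
  shows "r \<le> bdist G x"
proof -
  have "x \<in> G" using assms by auto
  then have ne: "frontier G \<noteq> {}" using frontier_nonempty assms by auto
  show ?thesis unfolding bdist_def infdist_notempty[OF ne]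
  proof (rule cINF_greatest[OF ne])
    fix z assume "z \<in> frontier G"
    then have "z \<notin> ball x r" using assms by (auto simp: frontier_def interior_open)
    then show "r \<le> dist x z" by simp
  qed
qed

text \<open>Along the segment from \<open>x\<close> to \<open>c\<close> the distance to the boundary is at least
  \<open>max (d - t \<ell>) (t w)\<close>, where \<open>d\<close> is its value at \<open>x\<close> and \<open>\<ell> = dist x c\<close>.\<close>

lemma qh_bound_star:
  fixes G :: "'a::euclidean_space set"
  assumes G: "bounded G" "open G" and Q: "convex Q" "Q \<subseteq> G" "x \<in> Q" "ball c w \<subseteq> Q" "w > 0"
    and n: "dist x c \<le> n * w"
  shows "qh_bound G x c (2 * n * ln (1 + (n + 1) * w / bdist G x))"
proof (cases "x = c")
  case True
  have "x \<in> G" using Q by auto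
  have "0 \<le> n * w" using n by (meson order_trans zero_le_dist)
  then have n0: "0 \<le> n" using Q(5) by (simp add: zero_le_mult_iff)
  have "0 \<le> bdist G x" by (simp add: bdist_def infdist_nonneg)
  then have "0 \<le> 2 * n * ln (1 + (n + 1) * w / bdist G x)" using n0 Q(5)
    by (intro mult_nonneg_nonneg ln_ge_zero) auto
  then show ?thesis using qh_bound_mono[OF qh_bound_trivial[OF \<open>x \<in> G\<close>]] True by auto
next
  case False
  define l where "l = dist x c"
  have l: "l > 0" using False by (simp add: l_def)
  have n0: "0 < n" using n l Q(5) by (metis l_def less_le_trans zero_less_mult_pos2)
  define d where "d = bdist G x"
  have xG: "x \<in> G" using Q by auto
  obtain r where r: "r > 0" "ball x r \<subseteq> G" using G(2) xG openE by blast
  have d: "d > 0" using bdist_ge[OF G r(2,1)] r(1) by (simp add: d_def)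
  \<comment> \<open>A lower bound on the whole segment: if \<beta> is the boundary distance at
    \<open>g s\<close>, then \<open>d - s\<close> \<le> \<beta> and \<open>s\<close> \<le>
    \<open>n\<close> \<beta>, hence \<open>d\<close> \<le> \<open>(n + 1)\<close> \<beta>.\<close>
  define D where "D = d / (n + 1)"
  have D: "D > 0" using d n0 by (simp add: D_def)
  define e where "e = (c - x) /\<^sub>R l"
  have ne: "norm e = 1" using l by (simp add: e_def l_def dist_norm norm_minus_commute)
  have le: "l *\<^sub>R e = c - x" using l by (simp add: e_def)
  define g where "g = (\<lambda>s. x + s *\<^sub>R e)"
  \<comment> \<open>The reciprocal of the average of the two lower bounds \<open>D\<close> and
    \<open>s * (w / l)\<close>; it integrates to a logarithm.\<close>
  define \<psi> where "\<psi> = (\<lambda>s. 2 / (D + s * (w / l)))"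
  have gt: "g s = (1 - s / l) *\<^sub>R x + (s / l) *\<^sub>R c" for s
  proof -
    have "g s = x + (s / l) *\<^sub>R (c - x)" unfolding g_def le[symmetric] using l by simp
    then show ?thesis by (simp add: algebra_simps)
  qed
  \<comment> \<open>This ball is the image of \<open>ball c w\<close> under the homothety with
    centre \<open>x\<close> and ratio \<open>s / l\<close>, hence in \<open>Q\<close> by
    convexity.\<close>
  have ball: "ball (g s) ((s / l) * w) \<subseteq> Q" if s: "0 < s" "s \<le> l" for s
  proof
    fix y assume "y \<in> ball (g s) ((s / l) * w)"
    then have y: "norm (g s - y) < (s / l) * w" by (simp add: dist_norm)
    define t where "t = s / l"
    have t: "0 < t" "t \<le> 1" using s l by (auto simp: t_def)
    define q where "q = c + (y - g s) /\<^sub>R t"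
    have "norm (c - q) = norm (g s - y) / t" using t unfolding q_def
      by (simp add: norm_minus_commute divide_inverse mult.commute)
    also have "\<dots> < w" using y t unfolding t_def[symmetric] by (simp add: field_simps)
    finally have "norm (c - q) < w" .
    then have "q \<in> Q" using Q(4) by (auto simp: dist_norm)
    then have "(1 - t) *\<^sub>R x + t *\<^sub>R q \<in> Q" using Q(1,3) t by (intro convexD) auto
    also have "(1 - t) *\<^sub>R x + t *\<^sub>R q = g s + (y - g s)" unfolding q_def gt t_def[symmetric] using t
      by (simp add: algebra_simps)
    finally show "y \<in> Q" by simp
  qed
  have gG: "g s \<in> G" if "s \<in> {0..l}" for s
  proof (cases "s = 0")
    case True then show ?thesis using xG by (simp add: g_def)
  next
    case False
    then have "g s \<in> ball (g s) ((s / l) * w)" using that l Q(5) by auto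
    moreover have "ball (g s) ((s / l) * w) \<subseteq> Q" by (rule ball) (use that False in auto)
    ultimately show ?thesis using Q(2) by blast
  qed
  have bd: "(D + s * (w / l)) / 2 \<le> bdist G (g s)" if s: "s \<in> {0..l}" for s
  proof -
    have 1: "d - s \<le> bdist G (g s)"
      using bdist_Lipschitz[of G x "g s"] ne s by (simp add: d_def g_def dist_norm)
    have 2: "(s / l) * w \<le> bdist G (g s)"
    proof (cases "s = 0")
      case True then show ?thesis by (simp add: bdist_def infdist_nonneg)
    next
      case False
      then show ?thesis using bdist_ge[OF G, of "g s"] ball[of s] Q(2,5) s l by auto
    qed
    have "D \<le> bdist G (g s)"
    proof -
      have "l * (s / l) \<le> n * w * (s / l)" using n s l by (intro mult_right_mono) (auto simp: l_def)
      then have "n * (s / l * w) \<ge> s" using l by (simp add: ac_simps)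
      moreover have "n * (s / l * w) \<le> n * bdist G (g s)" using 2 n0 by (intro mult_left_mono) auto
      ultimately have "d \<le> (n + 1) * bdist G (g s)" using 1 by (simp add: algebra_simps)
      then show ?thesis using n0 by (simp add: D_def field_simps)
    qed
    with 2 show ?thesis by (simp add: field_simps)
  qed
  have pos: "0 < D + s * (w / l)" if "s \<in> {0..l}" for s
    using that D Q(5) l by (intro add_pos_nonneg) auto
  have "broken_line 1 {} g l"
    unfolding broken_line_def g_def using ne by (auto simp: dist_norm algebra_simps simp flip: scaleR_diff_left)
  moreover have "g 0 = x" "g l = c" using le by (auto simp: g_def)
  moreover have "(\<lambda>s. ennreal (\<psi> s)) \<in> borel_measurable lborel" unfolding \<psi>_def by measurable
  moreover have "ennreal (1 / bdist G (g s)) \<le> ennreal (\<psi> s)" if "s \<in> {0..l}" for s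
  proof (rule ennreal_leI)
    have "1 / bdist G (g s) \<le> 1 / ((D + s * (w / l)) / 2)"
      using bd[OF that] pos[OF that] by (intro divide_left_mono) auto
    then show "1 / bdist G (g s) \<le> \<psi> s" by (simp add: \<psi>_def)
  qed
  moreover have "(\<integral>\<^sup>+s\<in>{0..l}. ennreal (\<psi> s) \<partial>lborel) \<le> ennreal (2 * n * ln (1 + (n + 1) * w / bdist G x))"
  proof -
    define F where "F = (\<lambda>s. 2 * l / w * ln (D + s * (w / l)))"
    have "(\<integral>\<^sup>+s\<in>{0..l}. ennreal (\<psi> s) \<partial>lborel) = ennreal (F l - F 0)"
    proof (rule nn_integral_FTC_Icc)
      show "\<psi> \<in> borel_measurable borel" unfolding \<psi>_def by measurable
      fix s assume s: "s \<in> {0..l}"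
      have "(F has_real_derivative 2 * l / w * (w / l / (D + s * (w / l)))) (at s)"
        unfolding F_def using pos[OF s] by (auto intro!: derivative_eq_intros)
      moreover have "2 * l / w * (w / l / (D + s * (w / l))) = \<psi> s" using l Q(5) by (simp add: \<psi>_def)
      ultimately show "(F has_real_derivative \<psi> s) (at s)" by simp
    next
      fix s assume s: "s \<in> {0..l}"
      show "0 \<le> \<psi> s" using pos[OF s] by (simp add: \<psi>_def)
    qed (use l in auto)
    also have "F l - F 0 = 2 * l / w * ln (1 + (n + 1) * w / d)"
    proof -
      have "F l - F 0 = 2 * l / w * (ln (D + w) - ln D)" using l by (simp add: F_def right_diff_distrib)
      also have "ln (D + w) - ln D = ln ((D + w) / D)" using D Q(5) by (simp add: ln_div)
      also have "(D + w) / D = 1 + w / D" using D by (simp add: add_divide_distrib)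
      also have "w / D = (n + 1) * w / d" by (simp add: D_def)
      finally show ?thesis .
    qed
    also have "\<dots> \<le> 2 * n * ln (1 + (n + 1) * w / d)"
    proof (rule mult_right_mono)
      show "2 * l / w \<le> 2 * n" using n Q(5) by (simp add: l_def field_simps)
      show "0 \<le> ln (1 + (n + 1) * w / d)" using d n0 Q(5) by (intro ln_ge_zero) auto
    qed
    finally show ?thesis by (simp add: d_def ennreal_leI)
  qed
  ultimately show ?thesis unfolding qh_bound_def using l gG
    by (intro exI[of _ l] exI[of _ "{}"] exI[of _ g] exI[of _ "\<lambda>s. ennreal (\<psi> s)"]) auto
qed


section \<open>The profile of a bundle of channels\<close>

lemma DERIV_max_0_square:
  fixes x :: real
  shows "((\<lambda>x. (max 0 x)\<^sup>2) has_real_derivative 2 * max 0 x) (at x)"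
proof -
  consider "x > 0" | "x < 0" | "x = 0" by linarith
  then show ?thesis
  proof cases
    case 1
    have "((\<lambda>x. x\<^sup>2) has_real_derivative 2 * max 0 x) (at x)"
      using 1 by (auto intro!: derivative_eq_intros)
    moreover have "\<forall>\<^sub>F y in nhds x. (max 0 y)\<^sup>2 = y\<^sup>2"
      using eventually_nhds_in_open[of "{0<..}" x] 1 by (auto elim!: eventually_mono)
    ultimately show ?thesis by (simp add: DERIV_cong_ev)
  next
    case 2
    have "\<forall>\<^sub>F y in nhds x. (max 0 y)\<^sup>2 = 0"
      using eventually_nhds_in_open[of "{..<0}" x] 2 by (auto elim!: eventually_mono)
    moreover have "((\<lambda>x. 0) has_real_derivative 2 * max 0 x) (at x)" using 2 by simp
    ultimately show ?thesis by (subst DERIV_cong_ev[OF refl _ refl]) auto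
  next
    case 3
    have "((\<lambda>h::real. (max 0 h)\<^sup>2 / h) \<longlongrightarrow> 0) (at 0)"
    proof (rule Lim_null_comparison[where g = abs])
      show "\<forall>\<^sub>F h in at 0. norm ((max 0 h)\<^sup>2 / h) \<le> \<bar>h\<bar>"
        by (rule always_eventually) (auto simp: max_def power2_eq_square)
      show "(abs \<longlongrightarrow> (0::real)) (at 0)" using tendsto_rabs_zero[OF tendsto_ident_at] by simp
    qed
    then show ?thesis using 3 by (simp add: DERIV_def)
  qed
qed

text \<open>A piecewise quadratic step from 0 to 1 on \<open>[0,1]\<close>. Truncated powers make a
  single derivative formula valid at the breakpoints too.\<close>

definition smoothstep :: "real \<Rightarrow> real" where
  "smoothstep z = 2 * (max 0 z)\<^sup>2 - 4 * (max 0 (z - 1/2))\<^sup>2 + 2 * (max 0 (z - 1))\<^sup>2"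

definition tent :: "real \<Rightarrow> real" where
  "tent z = 4 * max 0 z - 8 * max 0 (z - 1/2) + 4 * max 0 (z - 1)"

lemma DERIV_smoothstep: "(smoothstep has_real_derivative tent z) (at z)"
proof -
  have *: "((\<lambda>x. (max 0 (x - c))\<^sup>2) has_real_derivative 2 * max 0 (z - c)) (at z)" for c :: real
  proof -
    have "((\<lambda>x. x - c) has_real_derivative 1) (at z)" by (auto intro!: derivative_eq_intros)
    from DERIV_chain2[OF DERIV_max_0_square this] show ?thesis by simp
  qed
  show ?thesis unfolding smoothstep_def[abs_def] tent_def
    by (rule DERIV_cong[OF DERIV_add[OF DERIV_diff[OF DERIV_cmult[OF DERIV_max_0_square]
          DERIV_cmult[OF *]] DERIV_cmult[OF *]]]) simp
qed

lemma smoothstep_le_0: "z \<le> 0 \<Longrightarrow> smoothstep z = 0"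
  by (simp add: smoothstep_def)

lemma smoothstep_ge_1: "1 \<le> z \<Longrightarrow> smoothstep z = 1"
  by (simp add: smoothstep_def power2_eq_square algebra_simps)

lemma tent_le_0: "z \<le> 0 \<Longrightarrow> tent z = 0" and tent_ge_1: "1 \<le> z \<Longrightarrow> tent z = 0"
  by (auto simp: tent_def)

lemma tent_bounds: "0 \<le> tent z" "tent z \<le> 2"
  by (auto simp: tent_def max_def)

lemma smoothstep_bounds: "0 \<le> smoothstep z" "smoothstep z \<le> 1"
proof -
  have mono: "smoothstep a \<le> smoothstep b" if "a \<le> b" for a b
    using that DERIV_smoothstep tent_bounds(1) by (intro DERIV_nonneg_imp_nondecreasing[of a b smoothstep]) blast+
  show "0 \<le> smoothstep z" using mono[of "min z 0" z] by (simp add: smoothstep_le_0)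
  show "smoothstep z \<le> 1" using mono[of z "max z 1"] by (simp add: smoothstep_ge_1)
qed

text \<open>The shape of a bundle of channels, in the normalised height \<open>z\<close>: \<open>widen M z * narrow M z\<close> is the
  local scale, \<open>spread M z\<close> the contraction of the segment along which the channels
  are attached, and \<open>fan M z\<close> the displacement of the channels in the remaining directions.
  Everything happens for \<open>z \<in> [0,2]\<close>; the scale grows from 1 to \<open>M\<close> and then drops to \<open>1/2\<close>.\<close>

definition widen :: "real \<Rightarrow> real \<Rightarrow> real" where
  "widen M z = exp (ln M * smoothstep z)"

definition narrow :: "real \<Rightarrow> real \<Rightarrow> real" where
  "narrow M z = exp (- ln (2 * M) * smoothstep (z - 1))"

definition stretch :: "real \<Rightarrow> real \<Rightarrow> real" where
  "stretch M z = widen M z * narrow M z"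

definition fade :: "real \<Rightarrow> real \<Rightarrow> real" where
  "fade M z = (M * narrow M z - 1/2) / (M - 1/2)"

definition spread :: "real \<Rightarrow> real \<Rightarrow> real" where
  "spread M z = 1/2 + fade M z / 2"

definition fan :: "real \<Rightarrow> real \<Rightarrow> real" where
  "fan M z = (widen M z - 1) / (M - 1) * fade M z"

context
  fixes M :: real
  assumes M: "2 \<le> M"
begin

lemma widen_le_0: "z \<le> 0 \<Longrightarrow> widen M z = 1" by (simp add: widen_def smoothstep_le_0)
lemma widen_ge_1: "1 \<le> z \<Longrightarrow> widen M z = M" using M by (simp add: widen_def smoothstep_ge_1)
lemma narrow_le_1: "z \<le> 1 \<Longrightarrow> narrow M z = 1" by (simp add: narrow_def smoothstep_le_0)
lemma narrow_ge_2: "2 \<le> z \<Longrightarrow> narrow M z = 1 / (2 * M)"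
  using M by (simp add: narrow_def smoothstep_ge_1 exp_minus inverse_eq_divide)

lemma widen_bounds: "1 \<le> widen M z" "widen M z \<le> M"
proof -
  have "0 \<le> ln M * smoothstep z" "ln M * smoothstep z \<le> ln M * 1"
    using M smoothstep_bounds[of z] by (auto intro!: mult_nonneg_nonneg mult_left_mono simp del: mult_1_right)
  then show "1 \<le> widen M z" "widen M z \<le> M" using M exp_le_cancel_iff[of _ "ln M"] by (auto simp: widen_def)
qed

lemma narrow_bounds: "1 / (2 * M) \<le> narrow M z" "narrow M z \<le> 1"
proof -
  have *: "0 \<le> ln (2 * M) * smoothstep (z - 1)" "ln (2 * M) * smoothstep (z - 1) \<le> ln (2 * M) * 1"
    using M smoothstep_bounds[of "z - 1"] by (auto intro!: mult_nonneg_nonneg mult_left_mono simp del: mult_1_right)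
  then show "narrow M z \<le> 1" by (simp add: narrow_def)
  have "exp (- ln (2 * M)) \<le> narrow M z" using *(2) by (simp add: narrow_def)
  then show "1 / (2 * M) \<le> narrow M z" using M by (simp add: exp_minus inverse_eq_divide)
qed

lemma stretch_pos: "0 < stretch M z"
  by (simp add: stretch_def widen_def narrow_def)

lemma stretch_le_0: "z \<le> 0 \<Longrightarrow> stretch M z = 1"
  by (simp add: stretch_def widen_le_0 narrow_le_1)

lemma stretch_ge_2: "2 \<le> z \<Longrightarrow> stretch M z = 1/2"
  using M by (simp add: stretch_def widen_ge_1 narrow_ge_2)

lemma stretch_ge_half: "1/2 \<le> stretch M z"
proof (cases "z \<le> 1")
  case True
  then show ?thesis using widen_bounds(1)[of z] by (simp add: stretch_def narrow_le_1)
next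
  case False
  then have "stretch M z = M * narrow M z" by (simp add: stretch_def widen_ge_1)
  also have "\<dots> \<ge> M * (1 / (2 * M))" using narrow_bounds(1)[of z] M by (intro mult_left_mono) auto
  finally show ?thesis using M by simp
qed

lemma fade_le_1: "z \<le> 1 \<Longrightarrow> fade M z = 1" using M by (simp add: fade_def narrow_le_1)
lemma fade_ge_2: "2 \<le> z \<Longrightarrow> fade M z = 0" using M by (simp add: fade_def narrow_ge_2)

lemma spread_le_0: "z \<le> 0 \<Longrightarrow> spread M z = 1" by (simp add: spread_def fade_le_1)
lemma spread_ge_2: "2 \<le> z \<Longrightarrow> spread M z = 1/2" by (simp add: spread_def fade_ge_2)
lemma fan_le_0: "z \<le> 0 \<Longrightarrow> fan M z = 0" by (simp add: fan_def widen_le_0)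
lemma fan_ge_2: "2 \<le> z \<Longrightarrow> fan M z = 0" by (simp add: fan_def fade_ge_2)

lemma fade_nonneg: "0 \<le> fade M z"
proof -
  have "M * (1 / (2 * M)) \<le> M * narrow M z" using narrow_bounds(1)[of z] M by (intro mult_left_mono) auto
  then show ?thesis using M by (simp add: fade_def)
qed

text \<open>This keeps channels apart that are separated by at least \<open>1 / J\<close> along the
  segment. While the scale grows, \<open>spread\<close> is 1; afterwards the claim reduces to
  \<open>0 \<le> (M - v) * (M - 1)\<close>.\<close>

lemma stretch_le_spread: "stretch M z \<le> M * spread M z"
proof (cases "z \<le> 1")
  case True
  then show ?thesis using widen_bounds(2)[of z] by (simp add: stretch_def narrow_le_1 spread_def fade_le_1)
next
  case False
  define v where "v = M * narrow M z"
  have v: "1/2 \<le> v" "v \<le> M" using stretch_ge_half[of z] False narrow_bounds(2)[of z] M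
    by (auto simp: v_def stretch_def widen_ge_1)
  have "(M - 1/2) * (2 * v) \<le> M * (M - 1/2) + M * (v - 1/2)"
  proof -
    have "M * (M - 1/2) + M * (v - 1/2) - (M - 1/2) * (2 * v) = (M - v) * (M - 1)"
      by (simp add: algebra_simps)
    moreover have "0 \<le> (M - v) * (M - 1)" using v M by (intro mult_nonneg_nonneg) auto
    ultimately show ?thesis by linarith
  qed
  then have "v \<le> M * (1/2 + (v - 1/2) / (M - 1/2) / 2)" using M by (simp add: field_simps)
  then show ?thesis using False by (simp add: stretch_def widen_ge_1 spread_def fade_def v_def)
qed

text \<open>At every height either the channels are thin enough to be separated by the spacing of
  the sites alone, or the fan separates different digits. The cases split at scale 2 on the way up
  and at scale 1 on the way down.\<close>

lemma spread_or_fan: "stretch M z \<le> 2 * spread M z \<or> stretch M z \<le> 2 * M * fan M z"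
proof (cases "z \<le> 1")
  case True
  then have g: "stretch M z = widen M z" "spread M z = 1" "fan M z = (widen M z - 1) / (M - 1)"
    by (auto simp: stretch_def narrow_le_1 spread_def fan_def fade_le_1)
  show ?thesis
  proof (cases "widen M z \<le> 2")
    case False
    have "widen M z * (M - 1) \<le> widen M z * M" using widen_bounds(1)[of z] by simp
    also have "\<dots> \<le> 2 * M * (widen M z - 1)" using False M by (simp add: algebra_simps)
    finally have "widen M z \<le> 2 * M * (widen M z - 1) / (M - 1)" using M by (subst pos_le_divide_eq) auto
    then show ?thesis by (simp add: g)
  qed (use g in auto)
next
  case False
  define v where "v = M * narrow M z"
  have g: "stretch M z = v" "spread M z = 1/2 + (v - 1/2) / (M - 1/2) / 2" "fan M z = (v - 1/2) / (M - 1/2)"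
    using False M by (auto simp: stretch_def widen_ge_1 spread_def fan_def fade_def v_def)
  have v: "1/2 \<le> v" using stretch_ge_half[of z] g by simp
  show ?thesis
  proof (cases "v \<le> 1")
    case True
    have "0 \<le> (v - 1/2) / (M - 1/2)" using v M by simp
    moreover have "2 * (1/2 + x / 2) = 1 + x" for x :: real by simp
    then have "2 * spread M z = 1 + (v - 1/2) / (M - 1/2)" by (simp only: g(2))
    ultimately show ?thesis using g(1) True by linarith
  next
    case False
    have "v * (M - 1/2) \<le> v * M" using v by simp
    also have "\<dots> \<le> 2 * M * (v - 1/2)" using False M by (simp add: algebra_simps)
    finally have "v \<le> 2 * M * (v - 1/2) / (M - 1/2)" using M by (subst pos_le_divide_eq) auto
    then show ?thesis unfolding g by simp
  qed
qed

lemma DERIV_widen: "(widen M has_real_derivative widen M z * (ln M * tent z)) (at z)"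
  unfolding widen_def[abs_def]
  by (auto intro!: derivative_eq_intros DERIV_smoothstep)

lemma DERIV_narrow: "(narrow M has_real_derivative narrow M z * (- ln (2 * M) * tent (z - 1))) (at z)"
proof -
  have "((\<lambda>z. smoothstep (z - 1)) has_real_derivative tent (z - 1)) (at z)"
  proof -
    have "((\<lambda>z. z - 1) has_real_derivative 1) (at z)" by (auto intro!: derivative_eq_intros)
    from DERIV_chain2[OF DERIV_smoothstep this] show ?thesis by simp
  qed
  then show ?thesis unfolding narrow_def[abs_def] by (auto intro!: derivative_eq_intros)
qed

lemma stretch_derivative: "\<exists>d. (stretch M has_real_derivative d) (at z) \<and> \<bar>d\<bar> \<le> 4 * ln (2 * M) * stretch M z"
proof -
  define d where "d = stretch M z * (ln M * tent z - ln (2 * M) * tent (z - 1))"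
  have "(stretch M has_real_derivative d) (at z)"
    unfolding stretch_def[abs_def] d_def
    by (rule derivative_eq_intros DERIV_widen DERIV_narrow refl)+ (simp add: algebra_simps)
  moreover have "\<bar>ln M * tent z - ln (2 * M) * tent (z - 1)\<bar> \<le> 4 * ln (2 * M)"
  proof -
    have "0 \<le> ln M * tent z" "ln M * tent z \<le> ln (2 * M) * 2"
      "0 \<le> ln (2 * M) * tent (z - 1)" "ln (2 * M) * tent (z - 1) \<le> ln (2 * M) * 2"
      using M tent_bounds[of z] tent_bounds[of "z - 1"]
      by (auto intro!: mult_nonneg_nonneg mult_mono)
    then show ?thesis by linarith
  qed
  then have "\<bar>d\<bar> \<le> stretch M z * (4 * ln (2 * M))"
    unfolding d_def abs_mult using stretch_pos[of z] by (simp add: mult_left_mono)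
  ultimately show ?thesis by (intro exI[of _ d]) (simp add: ac_simps)
qed

text \<open>The gain \<open>1 / M\<close> comes from the denominator \<open>M - 1/2\<close>, which
  is at least \<open>M / 2\<close>. The clause for \<open>z \<le> 1\<close> serves the product rule
  in \<open>fan_derivative\<close>.\<close>

lemma fade_derivative:
  "\<exists>d. (fade M has_real_derivative d) (at z) \<and> \<bar>d\<bar> \<le> 4 * ln (2 * M) * stretch M z / M \<and> (z \<le> 1 \<longrightarrow> d = 0)"
proof -
  define d where "d = M * (narrow M z * (- ln (2 * M) * tent (z - 1))) / (M - 1/2)"
  have D: "(fade M has_real_derivative d) (at z)"
    unfolding fade_def[abs_def] d_def using M
    by (auto intro!: derivative_eq_intros DERIV_narrow)
  have z: "d = 0" if "z \<le> 1" using that by (simp add: d_def tent_le_0)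
  have "\<bar>d\<bar> \<le> 4 * ln (2 * M) * stretch M z / M"
  proof (cases "z \<le> 1")
    case True
    then show ?thesis using z M stretch_pos[of z] by simp
  next
    case False
    then have g: "stretch M z = M * narrow M z" by (simp add: stretch_def widen_ge_1)
    have "\<bar>d\<bar> = stretch M z * (ln (2 * M) * tent (z - 1)) / (M - 1/2)"
      using M tent_bounds(1)[of "z - 1"] narrow_bounds(1)[of z]
      by (simp add: d_def g abs_mult narrow_def)
    also have "\<dots> \<le> stretch M z * (ln (2 * M) * 2) / (M / 2)"
      using M tent_bounds[of "z - 1"] stretch_pos[of z]
      by (intro frac_le mult_left_mono mult_nonneg_nonneg) auto
    finally show ?thesis by (simp add: ac_simps)
  qed
  with D z show ?thesis by blast
qed

lemma spread_derivative:
  "\<exists>d. (spread M has_real_derivative d) (at z) \<and> \<bar>d\<bar> \<le> 2 * ln (2 * M) * stretch M z / M"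
proof -
  obtain d where d: "(fade M has_real_derivative d) (at z)" "\<bar>d\<bar> \<le> 4 * ln (2 * M) * stretch M z / M"
    using fade_derivative by blast
  have "(spread M has_real_derivative d / 2) (at z)"
    unfolding spread_def[abs_def] using d(1) by (auto intro!: derivative_eq_intros)
  then show ?thesis using d(2) by (intro exI[of _ "d / 2"]) auto
qed

text \<open>Only \<open>widen\<close> varies for \<open>z \<le> 1\<close> and only
  \<open>fade\<close> for \<open>z > 1\<close>, so one term of the product rule always
  vanishes.\<close>

lemma fan_derivative:
  "\<exists>d. (fan M has_real_derivative d) (at z) \<and> \<bar>d\<bar> \<le> 4 * ln (2 * M) * stretch M z / M"
proof -
  obtain d where d: "(fade M has_real_derivative d) (at z)" "\<bar>d\<bar> \<le> 4 * ln (2 * M) * stretch M z / M"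
    "z \<le> 1 \<Longrightarrow> d = 0"
    using fade_derivative by blast
  define b where "b = widen M z * (ln M * tent z) / (M - 1) * fade M z + (widen M z - 1) / (M - 1) * d"
  have "(fan M has_real_derivative b) (at z)"
    unfolding fan_def[abs_def] b_def
    by (rule DERIV_cong[OF DERIV_mult[OF DERIV_cdivide[OF DERIV_diff[OF DERIV_widen DERIV_const]] d(1)]]) simp
  moreover have "\<bar>b\<bar> \<le> 4 * ln (2 * M) * stretch M z / M"
  proof (cases "z \<le> 1")
    case True
    then have g: "stretch M z = widen M z" by (simp add: stretch_def narrow_le_1)
    have "b = stretch M z * (ln M * tent z) / (M - 1)" using True d(3) by (simp add: b_def g fade_le_1)
    moreover have "0 \<le> stretch M z * (ln M * tent z) / (M - 1)"
      using M tent_bounds[of z] stretch_pos[of z] by simp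
    ultimately have "\<bar>b\<bar> = stretch M z * (ln M * tent z) / (M - 1)" by (simp only: abs_of_nonneg)
    also have "\<dots> \<le> stretch M z * (ln (2 * M) * 2) / (M / 2)"
      using M tent_bounds[of z] stretch_pos[of z]
      by (intro frac_le mult_left_mono mult_mono mult_nonneg_nonneg) auto
    finally show ?thesis by (simp add: ac_simps)
  next
    case False
    then have "b = d" using M by (simp add: b_def widen_ge_1 tent_ge_1)
    then show ?thesis using d(2) by simp
  qed
  ultimately show ?thesis by blast
qed

end


section \<open>The domain\<close>

lemma ln_over_self_le:
  fixes x :: real
  assumes "0 < x"
  shows "ln x / x \<le> 2 / sqrt x"
proof -
  have "ln x = 2 * ln (sqrt x)" using assms by (simp add: ln_sqrt)
  also have "\<dots> \<le> 2 * sqrt x" using ln_le_minus_one[of "sqrt x"] assms by simp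
  finally have "ln x / x \<le> 2 * sqrt x / x" using assms by (simp add: divide_right_mono)
  also have "\<dots> = 2 / sqrt x"
    using real_div_sqrt[of x] assms by (simp add: field_simps)
  finally show ?thesis .
qed

section \<open>Numerical sizes of hubs and channels\<close>

locale channel_sizes =
  fixes n :: nat
  assumes n3: "3 \<le> n"
begin

text \<open>Hub \<open>m\<close> occupies the heights between \<open>b m\<close> and \<open>b m + 2 * w m\<close>, with middle \<open>al m\<close>. The channels
  from hub \<open>m\<close> to hub \<open>Suc m\<close> use the parameters of index \<open>Suc m\<close>: they have half-width \<open>w\<close> and length
  \<open>2 * run\<close>, and in the image their scale grows by the factor \<open>M = 1 / (2 * J * w)\<close>, the largest one for which
  they stay disjoint.\<close>

definition J :: "nat \<Rightarrow> nat" where "J m = 2 ^ Suc m"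
definition w :: "nat \<Rightarrow> real" where "w m = 1 / (8 * real (J m) ^ n)"
definition N :: "nat \<Rightarrow> nat" where "N m = J m ^ (n - 1)"
definition M :: "nat \<Rightarrow> real" where "M m = 4 * real (J m) ^ (n - 1)"
definition Lam :: "nat \<Rightarrow> real" where "Lam m = ln (2 * M m)"
definition run :: "nat \<Rightarrow> real" where "run m = real (J m) * w m * Lam m"

primrec b :: "nat \<Rightarrow> real" where
  "b 0 = 0"
| "b (Suc m) = b m + 2 * w m + 2 * run (Suc m)"

definition al :: "nat \<Rightarrow> real" where "al m = b m + w m"

lemma J_pos: "0 < J m" and J_ge_2: "2 \<le> real (J m)" and J_Suc: "J (Suc m) = 2 * J m"
  by (auto simp: J_def)

lemma J_power_ge: "1 \<le> real (J m) ^ k"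
  using J_ge_2[of m] by (intro one_le_power) auto

lemma J_power_n: "real (J m) ^ n = real (J m) * real (J m) ^ (n - 1)"
  using n3 by (metis power_eq_if not_numeral_le_zero)

lemma w_pos: "0 < w m"
  using J_pos[of m] by (simp add: w_def)

lemma w_Suc: "w m = 2 ^ n * w (Suc m)"
  by (simp add: w_def J_Suc power_mult_distrib)

lemma w_Suc_le: "w (Suc m) \<le> w m"
  using w_pos[of "Suc m"] by (simp add: w_Suc[of m] mult_le_cancel_right1)

lemma w_antimono: "k \<le> m \<Longrightarrow> w m \<le> w k"
  by (rule lift_Suc_antimono_le[of w]) (auto intro: w_Suc_le)

lemma M_ge_2: "2 \<le> M m"
  using J_power_ge[of m "n - 1"] by (simp add: M_def)

lemma J_w: "real (J m) * w m = 1 / (2 * M m)"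
  using J_pos[of m] by (simp add: w_def M_def J_power_n)

lemma N_pos: "0 < N m"
  using J_pos[of m] by (simp add: N_def)

text \<open>Neighbouring sites are \<open>1 / N\<close> apart and channels are \<open>2 * w\<close>
  wide; so channels of one level are disjoint and rounding can recover their numbers.\<close>

lemma w_le_N: "4 * w m * real (N m) \<le> 1"
proof -
  have "4 * w m * real (N m) = 1 / (2 * real (J m))"
    using J_pos[of m] by (simp add: w_def N_def J_power_n)
  then show ?thesis using J_ge_2[of m] by simp
qed

text \<open>The cost of moving from one site to the next at distance \<open>w\<close> from the
  boundary.\<close>

lemma N_w: "1 / real (N m) / w m = 8 * real (J m)"
  using J_pos[of m] by (simp add: w_def N_def J_power_n)

lemma w_le_power: "8 * w m \<le> (1/2) ^ Suc m"
proof -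
  have "real (J m) ^ 1 \<le> real (J m) ^ n"
    using J_ge_2[of m] n3 by (intro power_increasing) auto
  then have "1 / real (J m) ^ n \<le> 1 / real (J m)"
    using J_pos[of m] by (intro divide_left_mono) auto
  then show ?thesis by (simp add: w_def J_def power_one_over)
qed

lemma w_le: "w m \<le> 1/16"
proof -
  have "(1/2::real) ^ Suc m \<le> 1/2" by (simp add: power_le_one)
  then show ?thesis using w_le_power[of m] by linarith
qed

lemma Lam_pos: "0 < Lam m"
  using M_ge_2[of m] by (simp add: Lam_def)

lemma run_pos: "0 < run m"
  using J_pos[of m] w_pos[of m] Lam_pos[of m] by (simp add: run_def)

text \<open>Here \<open>n \<ge> 3\<close> gives \<open>J^2 \<le> J^(n-1)\<close>: the logarithm is
  absorbed by a square root of \<open>2 * M\<close>, which is still at least \<open>J\<close>. Hence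
  the channel lengths are summable.\<close>

lemma run_le: "run m \<le> 2 * (1/2) ^ Suc m"
proof -
  have "real (J m) ^ 2 \<le> real (J m) ^ (n - 1)"
    using J_ge_2[of m] n3 by (intro power_increasing) auto
  also have "\<dots> \<le> 2 * M m" using J_power_ge[of m "n - 1"] by (simp add: M_def)
  finally have *: "real (J m) \<le> sqrt (2 * M m)"
    using J_pos[of m] by (simp add: real_le_rsqrt)
  have "run m = ln (2 * M m) / (2 * M m)" unfolding run_def J_w by (simp add: Lam_def)
  also have "\<dots> \<le> 2 / sqrt (2 * M m)" using M_ge_2[of m] by (intro ln_over_self_le) auto
  also have "\<dots> \<le> 2 / real (J m)" using * J_pos[of m] M_ge_2[of m]
    by (intro divide_left_mono mult_pos_pos) auto
  also have "\<dots> = 2 * (1/2) ^ Suc m" by (simp add: J_def power_one_over)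
  finally show ?thesis .
qed

lemma b_less_Suc: "b m + 2 * w m < b (Suc m)"
  using run_pos[of "Suc m"] by simp

lemma b_strict_mono: "k < m \<Longrightarrow> b k < b m"
  by (rule lift_Suc_mono_less[of b]) (use b_less_Suc w_pos in \<open>smt (verit)\<close>)

lemma b_mono: "k \<le> m \<Longrightarrow> b k \<le> b m"
  using b_strict_mono by (cases "k = m") (auto simp: less_imp_le)

lemma b_gap: "k < m \<Longrightarrow> b k + 2 * w k < b m"
  using b_less_Suc[of k] b_mono[of "Suc k" m] by simp

lemma al_le: "k < m \<Longrightarrow> al (Suc k) \<le> b m + w m"
  using b_gap[of "Suc k" m] w_pos[of "Suc k"] w_pos[of m] by (cases "Suc k = m") (auto simp: al_def)

lemma b_bounded: "b m \<le> 4"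
proof -
  \<comment> \<open>The deficit drops by \<open>2 * (1/2) ^ m\<close> in one step, while the height
    grows by at most \<open>3/2 * (1/2) ^ m\<close>.\<close>
  have "b m \<le> 4 - 4 * (1/2) ^ m"
  proof (induction m)
    case (Suc m)
    have "2 * w m \<le> (1/2) ^ m / 2" using w_le_power[of m] w_pos[of m] by simp
    moreover have "2 * run (Suc m) \<le> (1/2) ^ m" using run_le[of "Suc m"] by simp
    moreover have "(0::real) \<le> (1/2) ^ m" by simp
    ultimately show ?case using Suc unfolding b.simps power_Suc by linarith
  qed simp
  moreover have "(0::real) < (1/2) ^ m" by simp
  ultimately show ?thesis by linarith
qed

lemma al_less_Suc: "al m < al (Suc m)"
  using b_less_Suc[of m] w_pos[of m] w_pos[of "Suc m"] by (simp add: al_def)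

section \<open>The cost of descending through the levels\<close>

definition L :: "nat \<Rightarrow> real" where "L m = ln (1 / w m)"

lemma L_ge_1: "1 \<le> L m"
proof -
  have "exp 1 \<le> (3::real)" using exp_le by simp
  also have "3 \<le> 1 / w m" using w_le[of m] w_pos[of m] by (simp add: field_simps)
  finally show ?thesis unfolding L_def using w_pos[of m] by (subst ln_ge_iff) auto
qed

lemma L_mono: "L m \<le> L (Suc m)"
  unfolding L_def using w_Suc_le[of m] w_pos[of m] w_pos[of "Suc m"] by (simp add: frac_le)

lemma Lam_le_L: "Lam m \<le> L m"
proof -
  have "2 * M m \<le> 1 / w m" using J_ge_2[of m] J_power_ge[of m "n - 1"] by (simp add: M_def w_def J_power_n)
  then show ?thesis using M_ge_2[of m] w_pos[of m] by (simp add: Lam_def L_def)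
qed

text \<open>In \<open>climb_cost\<close>, 8 pays for reaching a site, \<open>2 ^ n + 1\<close> for
  the ends of a channel inside the two hubs, and 2 for its part between them.\<close>

definition C1 :: real where "C1 = 11 + 2 ^ n"
text \<open>A bound for the cost from hub \<open>m\<close> down to the base point. Since
  \<open>J\<close> doubles from level to level, the sum over all levels is at most twice its last
  term; \<open>1 / w 0\<close> pays for crossing hub 0.\<close>

definition P :: "nat \<Rightarrow> real" where "P m = (2 * C1 + 1 / w 0) * real (J m) * L m"

lemma climb_cost: "8 * real (J (Suc m)) + (al (Suc m) - al m) / w (Suc m) \<le> C1 * real (J (Suc m)) * L (Suc m)"
proof -
  define j l where "j = real (J (Suc m))" and "l = L (Suc m)"
  have jl: "1 \<le> j" "1 \<le> l" using J_ge_2[of "Suc m"] L_ge_1[of "Suc m"] by (auto simp: j_def l_def)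
  have "(al (Suc m) - al m) / w (Suc m) = (2 ^ n * w (Suc m) + 2 * (j * w (Suc m) * Lam (Suc m)) + w (Suc m)) / w (Suc m)"
    by (simp add: al_def run_def j_def w_Suc[of m])
  also have "\<dots> = 2 ^ n + 2 * (j * Lam (Suc m)) + 1"
    using w_pos[of "Suc m"] by (simp add: field_simps)
  also have "\<dots> \<le> 2 ^ n + 2 * (j * l) + 1"
    using Lam_le_L[of "Suc m"] jl by (simp add: l_def)
  finally have "8 * j + (al (Suc m) - al m) / w (Suc m) \<le> 8 * j + (2 ^ n + 1) + 2 * (j * l)" by simp
  also have "\<dots> \<le> 8 * (j * l) + (2 ^ n + 1) * (j * l) + 2 * (j * l)"
  proof -
    have "1 * 1 \<le> j * l" using jl by (intro mult_mono) auto
    then have "(2 ^ n + 1) * 1 \<le> (2 ^ n + 1) * (j * l)" by (intro mult_left_mono) auto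
    moreover have "j * 1 \<le> j * l" using jl by (intro mult_left_mono) auto
    ultimately show ?thesis by (intro add_mono) auto
  qed
  finally show ?thesis by (simp add: C1_def j_def l_def algebra_simps)
qed

lemma P_step: "P m + C1 * real (J (Suc m)) * L (Suc m) \<le> P (Suc m)"
proof -
  define x y where "x = real (J m) * L m" and "y = real (J (Suc m)) * L (Suc m)"
  have "2 * x \<le> y" unfolding x_def y_def using L_mono[of m] by (simp add: J_Suc mult_left_mono)
  moreover have "0 \<le> C1" "0 \<le> 1 / w 0" using w_pos[of 0] by (auto simp: C1_def)
  ultimately have "C1 * (2 * x) \<le> C1 * y" "1 / w 0 * (2 * x) \<le> 1 / w 0 * y"
    by (intro mult_left_mono; simp)+
  moreover have "0 \<le> 1 / w 0 * x" using w_pos[of 0] L_ge_1[of m] by (auto simp: x_def)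
  moreover have "P m = 2 * (C1 * x) + 1 / w 0 * x" "P (Suc m) = 2 * (C1 * y) + 1 / w 0 * y"
    by (simp_all add: P_def x_def y_def algebra_simps)
  moreover have "C1 * real (J (Suc m)) * L (Suc m) = C1 * y" by (simp add: y_def)
  ultimately show ?thesis by linarith
qed

lemma P_0: "1 / w 0 \<le> P 0"
proof -
  have "1 \<le> real (J 0) * L 0" using mult_mono[of 1 "real (J 0)" 1 "L 0"] J_ge_2[of 0] L_ge_1[of 0] by simp
  then have "(2 * C1 + 1 / w 0) * 1 \<le> (2 * C1 + 1 / w 0) * (real (J 0) * L 0)"
    using w_pos[of 0] by (intro mult_left_mono) (auto simp: C1_def)
  moreover have "0 \<le> C1" by (simp add: C1_def)
  ultimately show ?thesis by (simp add: P_def mult.assoc)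
qed

text \<open>The first two summands are the coefficients occurring in \<open>growth_bound\<close>;
  the rest makes \<open>C / d\<close> dominate the argument of the logarithm there.\<close>

definition C :: real where "C = 2 * real n + (2 * C1 + 1 / w 0) + real n + 2"

text \<open>\<open>J\<close> is the \<open>n\<close>-th root of \<open>1 / (8 * w)\<close>, hence at
  most \<open>d powr (- (1 / n))\<close> because \<open>d \<le> 2 * w\<close>. This produces the
  exponent of the theorem, and \<open>L \<le> ln (C / d)\<close> the logarithm.\<close>

lemma growth_bound:
  assumes d: "0 < d" "d \<le> 2 * w m"
  shows "2 * real n * ln (1 + (real n + 1) * w m / d) + P m
    \<le> C * d powr (- (1 / real n)) * ln (C / d)"
proof -
  define C2 where "C2 = 2 * C1 + 1 / w 0"
  define q where "q = d powr (- (1 / real n))"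
  define l where "l = ln (C / d)"
  have C2: "0 \<le> C2" using w_pos[of 0] by (simp add: C2_def C1_def)
  have CC: "C = 2 * real n + C2 + real n + 2" by (simp add: C_def C2_def)
  have wm: "0 < w m" "w m \<le> 1/16" using w_pos w_le by auto
  have d1: "d \<le> 1" using d wm by simp
  have q1: "1 \<le> q" unfolding q_def using d(1) d1 by (simp add: powr_minus_divide powr_le1)
  have "1 + (real n + 1) * w m / d \<le> C / d"
  proof -
    have "(real n + 1) * w m \<le> (real n + 1) * 1" using wm by (intro mult_left_mono) auto
    moreover have "C = 2 * real n + C2 + ((real n + 1) * 1 + 1)" by (simp add: CC)
    ultimately have "d + (real n + 1) * w m \<le> C" using d1 C2 by linarith
    then have "(d + (real n + 1) * w m) / d \<le> C / d" using d(1) by (intro divide_right_mono) auto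
    then show ?thesis using d(1) by (simp add: add_divide_distrib)
  qed
  moreover have "0 \<le> (real n + 1) * w m / d" using wm d by simp
  ultimately have 1: "ln (1 + (real n + 1) * w m / d) \<le> l" unfolding l_def
    by (subst ln_le_cancel_iff) auto
  have "1 / w m \<le> C / d"
  proof -
    have "d \<le> 2 * w m" by fact
    also have "\<dots> \<le> C * w m" using wm C2 by (simp add: CC algebra_simps)
    finally show ?thesis using d wm by (simp add: field_simps)
  qed
  then have 2: "L m \<le> l" unfolding L_def l_def using wm d(1)
    by (subst ln_le_cancel_iff) (auto intro: less_le_trans[rotated])
  have l0: "0 \<le> l" using 2 L_ge_1[of m] by simp
  have 3: "real (J m) \<le> q"
  proof -
    have "real (J m) = (real (J m) ^ n) powr (1 / real n)"
      using J_pos[of m] n3 by (simp add: powr_realpow[symmetric] powr_powr)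
    also have "real (J m) ^ n = 1 / (8 * w m)" by (simp add: w_def)
    also have "(1 / (8 * w m)) powr (1 / real n) \<le> (1 / d) powr (1 / real n)"
      using d wm by (intro powr_mono2 divide_left_mono) auto
    also have "\<dots> = q" using d by (simp add: q_def powr_minus_divide powr_divide)
    finally show ?thesis .
  qed
  have "2 * real n * ln (1 + (real n + 1) * w m / d) \<le> 2 * real n * (q * l)"
  proof (rule mult_left_mono)
    have "1 * l \<le> q * l" using q1 l0 by (intro mult_right_mono) auto
    then show "ln (1 + (real n + 1) * w m / d) \<le> q * l" using 1 by simp
  qed simp
  moreover have "P m \<le> C2 * (q * l)"
  proof -
    have "real (J m) * L m \<le> q * l" using 2 3 L_ge_1[of m] q1 by (intro mult_mono) auto
    then show ?thesis unfolding P_def C2_def[symmetric] mult.assoc using C2 by (intro mult_left_mono)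
  qed
  ultimately have "2 * real n * ln (1 + (real n + 1) * w m / d) + P m \<le> (2 * real n + C2) * (q * l)"
    by (simp add: distrib_right)
  also have "\<dots> \<le> C * (q * l)" using q1 l0 by (intro mult_right_mono) (auto simp: CC)
  finally show ?thesis by (simp add: q_def l_def mult.assoc)
qed

lemma C_pos: "0 < C"
  using w_pos[of 0] by (simp add: C_def C1_def add_pos_pos add_nonneg_pos)

end


section \<open>Cubes, and the geometry of the domain\<close>

definition cube :: "real^'n::finite \<Rightarrow> real \<Rightarrow> (real^'n) set" where
  "cube c r = {y. \<forall>j. \<bar>y $ j - c $ j\<bar> < r}"

lemma convex_cube: "convex (cube c r)"
proof -
  have "cube c r = (\<Inter>j. (\<lambda>y. y $ j) -` ball (c $ j) r)"
    by (auto simp: cube_def dist_real_def abs_minus_commute)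
  also have "convex \<dots>" by (intro convex_INT convex_linear_vimage convex_ball bounded_linear.linear bounded_linear_vec_nth)
  finally show ?thesis .
qed

lemma ball_subset_cube: "ball c r \<subseteq> cube c r"
proof
  fix y assume "y \<in> ball c r"
  then have "norm (y - c) < r" by (simp add: dist_norm norm_minus_commute)
  then show "y \<in> cube c r" using component_le_norm_cart[of "y - c"] by (auto simp: cube_def intro: le_less_trans)
qed

lemma dist_cube:
  fixes c :: "real^'n::finite"
  assumes "x \<in> cube c r"
  shows "dist x c \<le> real CARD('n) * r"
proof -
  have "dist x c \<le> (\<Sum>i\<in>UNIV. \<bar>(x - c) $ i\<bar>)" unfolding dist_norm by (rule norm_le_l1_cart)
  also have "\<dots> \<le> (\<Sum>i\<in>(UNIV::'n set). r)" using assms by (intro sum_mono) (auto simp: cube_def less_imp_le)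
  finally show ?thesis by simp
qed

lemma norm_axis: "norm (axis k x :: real^'n::finite) = \<bar>x\<bar>"
proof -
  have "axis k x = x *\<^sub>R (axis k 1 :: real^'n)" by (simp add: axis_def vec_eq_iff)
  then show ?thesis by (simp add: norm_axis_1)
qed

text \<open>\<open>e\<close> is the direction of the hubs and \<open>t\<close> that of the heights;
  \<open>pos\<close> assigns to each other direction the position of the digit that moves the
  channels in this direction.\<close>

locale channels = channel_sizes n for n :: nat +
  fixes e t :: "'n::finite" and pos :: "'n \<Rightarrow> nat"
  assumes n_card: "n = CARD('n)" and et: "e \<noteq> t"
    and pos: "bij_betw pos (UNIV - {e, t}) {..<n - 2}"
begin

text \<open>The overhang \<open>w m\<close> at both ends makes room for the cubes centred at the end
  points of the axis.\<close>

definition hub :: "nat \<Rightarrow> (real^'n) set" where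
  "hub m = {y. - w m < y $ e \<and> y $ e < 1 + w m \<and> b m < y $ t \<and> y $ t < b m + 2 * w m
     \<and> (\<forall>k. k \<noteq> e \<and> k \<noteq> t \<longrightarrow> \<bar>y $ k\<bar> < w m)}"

definition site :: "nat \<Rightarrow> nat \<Rightarrow> real" where
  "site m i = real i / real (N m)"

text \<open>Channels reach from the middle of one hub to the middle of the next; the overlaps
  connect the open pieces.\<close>

definition channel :: "nat \<Rightarrow> nat \<Rightarrow> (real^'n) set" where
  "channel m i = {y. \<bar>y $ e - site (Suc m) i\<bar> < w (Suc m) \<and> al m < y $ t \<and> y $ t < al (Suc m)
     \<and> (\<forall>k. k \<noteq> e \<and> k \<noteq> t \<longrightarrow> \<bar>y $ k\<bar> < w (Suc m))}"

definition Om :: "(real^'n) set" where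
  "Om = (\<Union>m. hub m) \<union> (\<Union>m. \<Union>i\<in>{..N (Suc m)}. channel m i)"

lemma site_bounds: "i \<le> N m \<Longrightarrow> 0 \<le> site m i \<and> site m i \<le> 1"
  using N_pos[of m] by (simp add: site_def)

lemma Om_cases:
  assumes "y \<in> Om"
  obtains (hub) m where "y \<in> hub m" | (channel) m i where "i \<le> N (Suc m)" "y \<in> channel m i"
  using assms by (auto simp: Om_def)

lemma hub_subset: "hub m \<subseteq> Om" by (auto simp: Om_def)
lemma channel_subset: "i \<le> N (Suc m) \<Longrightarrow> channel m i \<subseteq> Om" by (auto simp: Om_def)

lemma open_hub: "open (hub m)"
proof -
  have "hub m = {y. - w m < y $ e} \<inter> {y. y $ e < 1 + w m} \<inter> {y. b m < y $ t} \<inter> {y. y $ t < b m + 2 * w m}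
     \<inter> (\<Inter>k\<in>UNIV - {e, t}. {y. \<bar>y $ k\<bar> < w m})" by (auto simp: hub_def)
  also have "open \<dots>" by (intro open_Int open_INT ballI open_Collect_less continuous_intros) auto
  finally show ?thesis .
qed

lemma open_channel: "open (channel m i)"
proof -
  have "channel m i = {y. \<bar>y $ e - site (Suc m) i\<bar> < w (Suc m)} \<inter> {y. al m < y $ t} \<inter> {y. y $ t < al (Suc m)}
     \<inter> (\<Inter>k\<in>UNIV - {e, t}. {y. \<bar>y $ k\<bar> < w (Suc m)})" by (auto simp: channel_def)
  also have "open \<dots>" by (intro open_Int open_INT ballI open_Collect_less continuous_intros) auto
  finally show ?thesis .
qed

lemma open_Om: "open Om"
  unfolding Om_def by (intro open_Un open_UN ballI open_hub open_channel)

lemma height_bounds: "y \<in> Om \<Longrightarrow> 0 < y $ t \<and> y $ t < 5"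
proof (erule Om_cases)
  fix m assume "y \<in> hub m"
  then show ?thesis using b_mono[of 0 m] b_bounded[of m] w_le[of m] by (auto simp: hub_def)
next
  fix m i assume "y \<in> channel m i"
  then show ?thesis using b_mono[of 0 m] b_bounded[of "Suc m"] w_le[of "Suc m"] w_pos[of m]
    by (auto simp: channel_def al_def simp del: b.simps(2))
qed

lemma e_bounds: "y \<in> Om \<Longrightarrow> - 1 < y $ e \<and> y $ e < 2"
proof (erule Om_cases)
  fix m assume "y \<in> hub m"
  then show ?thesis using w_le[of m] by (auto simp: hub_def)
next
  fix m i assume "i \<le> N (Suc m)" "y \<in> channel m i"
  then show ?thesis using w_le[of "Suc m"] site_bounds[of i "Suc m"] by (auto simp: channel_def)
qed

lemma side_bounds: "y \<in> Om \<Longrightarrow> k \<noteq> e \<Longrightarrow> k \<noteq> t \<Longrightarrow> \<bar>y $ k\<bar> < 1"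
proof (erule Om_cases)
  fix m assume "y \<in> hub m" "k \<noteq> e" "k \<noteq> t"
  then have "\<bar>y $ k\<bar> < w m" by (simp add: hub_def)
  then show ?thesis using w_le[of m] by linarith
next
  fix m i assume "y \<in> channel m i" "k \<noteq> e" "k \<noteq> t"
  then have "\<bar>y $ k\<bar> < w (Suc m)" by (simp add: channel_def)
  then show ?thesis using w_le[of "Suc m"] by linarith
qed

lemma bounded_Om: "bounded Om"
proof (rule bounded_subset)
  show "Om \<subseteq> cball 0 (\<Sum>i\<in>(UNIV::'n set). 5)"
  proof
    fix y assume y: "y \<in> Om"
    have "norm y \<le> (\<Sum>i\<in>UNIV. \<bar>y $ i\<bar>)" by (rule norm_le_l1_cart)
    also have "\<dots> \<le> (\<Sum>i\<in>(UNIV::'n set). 5)"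
    proof (rule sum_mono)
      fix i show "\<bar>y $ i\<bar> \<le> 5"
        using height_bounds[OF y] e_bounds[OF y] side_bounds[OF y, of i]
        by (cases "i = e"; cases "i = t") auto
    qed
    finally show "y \<in> cball 0 (\<Sum>i\<in>(UNIV::'n set). 5)" by simp
  qed
qed simp

text \<open>Pieces of lower index end below the height \<open>b m\<close>, and half-widths decrease
  with the index.\<close>

lemma side_less_hub:
  assumes "y \<in> Om" "b m < y $ t" "k \<noteq> e" "k \<noteq> t"
  shows "\<bar>y $ k\<bar> < w m"
  using assms(1)
proof (cases rule: Om_cases)
  case (hub j)
  then have k: "\<bar>y $ k\<bar> < w j" and "y $ t < b j + 2 * w j" using assms by (auto simp: hub_def)
  then have "\<not> j < m" using b_gap[of j m] assms(2) by auto
  then show ?thesis using k w_antimono[of m j] by simp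
next
  case (channel j i)
  then have k: "\<bar>y $ k\<bar> < w (Suc j)" and h: "y $ t < al (Suc j)" using assms by (auto simp: channel_def)
  have "\<not> Suc j < m" using b_gap[of "Suc j" m] assms(2) h w_pos[of "Suc j"] by (auto simp: al_def)
  then show ?thesis using k w_antimono[of m "Suc j"] by simp
qed

text \<open>The pieces are ordered by height: in the slab between two hubs, those of lower level
  have ended and those of higher level have not begun.\<close>

lemma hub_range:
  assumes "y \<in> Om" "b m + 2 * w m \<le> y $ t" "y $ t \<le> b (Suc m)"
  shows "\<exists>i\<le>N (Suc m). y \<in> channel m i"
  using assms(1)
proof (cases rule: Om_cases)
  case (hub j)
  then have h: "b j < y $ t" "y $ t < b j + 2 * w j" by (auto simp: hub_def)
  consider "j < m" | "j = m" | "m < j" by linarith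
  then show ?thesis
    using b_gap[of j m] b_mono[of "Suc m" j] w_pos[of m] assms h by cases (auto simp del: b.simps(2))
next
  case (channel j i)
  then have h: "al j < y $ t" "y $ t < al (Suc j)" by (auto simp: channel_def)
  consider "j < m" | "j = m" | "m < j" by linarith
  then show ?thesis
    using al_le[of j m] b_mono[of "Suc m" j] w_pos[of m] w_pos[of j] assms h channel
    by cases (auto simp: al_def simp del: b.simps(2))
qed

lemma side_less_channel:
  assumes "y \<in> Om" "b m + 2 * w m \<le> y $ t" "k \<noteq> e" "k \<noteq> t"
  shows "\<bar>y $ k\<bar> < w (Suc m)"
proof (cases "y $ t \<le> b (Suc m)")
  case True
  then show ?thesis using hub_range[OF assms(1,2)] assms by (auto simp: channel_def)
next
  case False
  then show ?thesis using side_less_hub[OF assms(1), of "Suc m"] assms by simp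
qed

lemma third_axis: "\<exists>k. k \<noteq> e \<and> k \<noteq> t"
proof -
  have "card {e, t} < CARD('n)" using n3 n_card et by simp
  then have "UNIV \<noteq> {e, t}" by (metis less_irrefl)
  then show ?thesis by blast
qed

text \<open>A move of length at most \<open>2 * r\<close> in a side direction, at constant height,
  leaves \<open>Om\<close>.\<close>

lemma bdist_le_side:
  assumes y: "y \<in> Om" and r: "\<And>z k. z \<in> Om \<Longrightarrow> z $ t = y $ t \<Longrightarrow> k \<noteq> e \<Longrightarrow> k \<noteq> t \<Longrightarrow> \<bar>z $ k\<bar> < r"
  shows "bdist Om y \<le> 2 * r"
proof -
  obtain k where k: "k \<noteq> e" "k \<noteq> t" using third_axis by blast
  define z where "z = y + axis k (r - y $ k)"
  have yk: "\<bar>y $ k\<bar> < r" using r[OF y refl k] .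
  have "z $ t = y $ t" "z $ k = r" using k by (auto simp: z_def axis_def)
  then have "z \<notin> Om" using r[of z k] k by auto
  then have "bdist Om y \<le> dist y z" by (rule bdist_le_dist[OF y])
  also have "\<dots> = \<bar>r - y $ k\<bar>" by (simp add: z_def dist_norm norm_axis)
  also have "\<dots> \<le> 2 * r" using yk by linarith
  finally show ?thesis .
qed

definition pt :: "real \<Rightarrow> real \<Rightarrow> real^'n" where
  "pt \<xi> s = (\<chi> j. if j = e then \<xi> else if j = t then s else 0)"

lemma pt_nth [simp]: "pt \<xi> s $ e = \<xi>" "pt \<xi> s $ t = s" "k \<noteq> e \<Longrightarrow> k \<noteq> t \<Longrightarrow> pt \<xi> s $ k = 0"
  using et by (auto simp: pt_def)

lemma cube_pt: "y \<in> cube (pt \<xi> s) r \<longleftrightarrow> \<bar>y $ e - \<xi>\<bar> < r \<and> \<bar>y $ t - s\<bar> < r \<and> (\<forall>k. k \<noteq> e \<and> k \<noteq> t \<longrightarrow> \<bar>y $ k\<bar> < r)"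
  unfolding cube_def mem_Collect_eq
proof safe
  fix j assume h: "\<bar>y $ e - \<xi>\<bar> < r" "\<bar>y $ t - s\<bar> < r" "\<forall>k. k \<noteq> e \<and> k \<noteq> t \<longrightarrow> \<bar>y $ k\<bar> < r"
  show "\<bar>y $ j - pt \<xi> s $ j\<bar> < r" using h et by (cases "j = e"; cases "j = t") auto
next
  fix k assume "\<forall>j. \<bar>y $ j - pt \<xi> s $ j\<bar> < r" "k \<noteq> e" "k \<noteq> t"
  then show "\<bar>y $ k\<bar> < r" by (metis pt_nth(3) diff_zero)
qed (metis pt_nth)+

lemma cube_hub: "0 \<le> \<xi> \<Longrightarrow> \<xi> \<le> 1 \<Longrightarrow> cube (pt \<xi> (al m)) (w m) \<subseteq> hub m"
  by (auto simp: cube_pt hub_def al_def abs_less_iff)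

text \<open>A cube near an end of the channel protrudes from it, but the protruding part lies in the
  hub, which is at least as wide.\<close>

lemma cube_channel:
  assumes i: "i \<le> N (Suc m)" and s: "al m \<le> s" "s \<le> al (Suc m)"
  shows "cube (pt (site (Suc m) i) s) (w (Suc m)) \<subseteq> Om"
proof
  fix y assume y: "y \<in> cube (pt (site (Suc m) i) s) (w (Suc m))"
  let ?\<xi> = "site (Suc m) i"
  have \<xi>: "0 \<le> ?\<xi>" "?\<xi> \<le> 1" using site_bounds[OF i] by auto
  have w: "w (Suc m) \<le> w m" by (rule w_Suc_le)
  consider "y $ t \<le> al m" | "al m < y $ t" "y $ t < al (Suc m)" | "al (Suc m) \<le> y $ t" by linarith
  then show "y \<in> Om"
  proof cases
    case 1
    then have "\<bar>y $ t - al m\<bar> < w (Suc m)" using y s by (auto simp: cube_pt)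
    then have "y \<in> cube (pt ?\<xi> (al m)) (w m)" using y w by (auto simp: cube_pt intro: less_le_trans)
    then show ?thesis using cube_hub[OF \<xi>] hub_subset by blast
  next
    case 2
    then show ?thesis using y channel_subset[OF i] by (auto simp: cube_pt channel_def)
  next
    case 3
    then have "\<bar>y $ t - al (Suc m)\<bar> < w (Suc m)" using y s by (auto simp: cube_pt)
    then have "y \<in> cube (pt ?\<xi> (al (Suc m))) (w (Suc m))" using y by (auto simp: cube_pt)
    then show ?thesis using cube_hub[OF \<xi>] hub_subset by blast
  qed
qed

lemma bdist_ge_cube:
  assumes "cube c r \<subseteq> Om" "0 < r"
  shows "c \<in> Om \<and> r \<le> bdist Om c"
  using bdist_ge[OF bounded_Om open_Om, of c r] ball_subset_cube[of c r] assms centre_in_ball[of c r] by blast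

lemma segment_pt:
  assumes "u \<in> closed_segment (pt \<xi> s) (pt \<xi>' s')"
  shows "\<exists>\<eta> r. u = pt \<eta> r \<and> \<eta> \<in> closed_segment \<xi> \<xi>' \<and> r \<in> closed_segment s s'"
proof -
  obtain v where v: "u = (1 - v) *\<^sub>R pt \<xi> s + v *\<^sub>R pt \<xi>' s'" "0 \<le> v" "v \<le> 1"
    using assms by (auto simp: closed_segment_def)
  have "u = pt ((1 - v) *\<^sub>R \<xi> + v *\<^sub>R \<xi>') ((1 - v) *\<^sub>R s + v *\<^sub>R s')"
    by (auto simp: v(1) pt_def vec_eq_iff)
  then show ?thesis using v(2,3) by (auto simp: closed_segment_def)
qed

lemma dist_pt_e: "dist (pt \<xi> s) (pt \<xi>' s) = \<bar>\<xi> - \<xi>'\<bar>"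
proof -
  have "pt \<xi> s - pt \<xi>' s = axis e (\<xi> - \<xi>')" by (auto simp: vec_eq_iff pt_def axis_def)
  then show ?thesis by (simp add: dist_norm norm_axis)
qed

lemma dist_pt_t: "dist (pt \<xi> s) (pt \<xi> s') = \<bar>s - s'\<bar>"
proof -
  have "pt \<xi> s - pt \<xi> s' = axis t (s - s')" using et by (auto simp: vec_eq_iff pt_def axis_def)
  then show ?thesis by (simp add: dist_norm norm_axis)
qed

section \<open>Travelling to the base point and the growth bound\<close>

lemma move_along_hub:
  assumes "qh_bound Om x (pt \<xi> (al m)) c" "0 \<le> c" "0 \<le> \<xi>" "\<xi> \<le> 1" "0 \<le> \<xi>'" "\<xi>' \<le> 1"
  shows "qh_bound Om x (pt \<xi>' (al m)) (c + \<bar>\<xi> - \<xi>'\<bar> / w m)"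
proof -
  have "qh_bound Om x (pt \<xi>' (al m)) (c + dist (pt \<xi> (al m)) (pt \<xi>' (al m)) / w m)"
  proof (rule qh_bound_append[OF assms(1,2) w_pos])
    fix u assume "u \<in> closed_segment (pt \<xi> (al m)) (pt \<xi>' (al m))"
    then obtain \<eta> where u: "u = pt \<eta> (al m)" "\<eta> \<in> closed_segment \<xi> \<xi>'" using segment_pt by fastforce
    then have "0 \<le> \<eta>" "\<eta> \<le> 1" using assms by (auto simp: closed_segment_eq_real_ivl split: if_splits)
    then show "u \<in> Om \<and> w m \<le> bdist Om u"
      unfolding u(1) using cube_hub[of \<eta> m] hub_subset by (intro bdist_ge_cube w_pos) blast
  qed
  then show ?thesis by (simp add: dist_pt_e)
qed

lemma move_along_channel:
  assumes x: "qh_bound Om x (pt (site (Suc m) i) s) c" "0 \<le> c"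
    and i: "i \<le> N (Suc m)" and s: "al m \<le> s" "s \<le> al (Suc m)"
  shows "qh_bound Om x (pt (site (Suc m) i) (al m)) (c + (s - al m) / w (Suc m))"
proof -
  have "qh_bound Om x (pt (site (Suc m) i) (al m))
     (c + dist (pt (site (Suc m) i) s) (pt (site (Suc m) i) (al m)) / w (Suc m))"
  proof (rule qh_bound_append[OF x w_pos])
    fix u assume "u \<in> closed_segment (pt (site (Suc m) i) s) (pt (site (Suc m) i) (al m))"
    then obtain r where u: "u = pt (site (Suc m) i) r" "r \<in> closed_segment s (al m)" using segment_pt by fastforce
    then have "al m \<le> r" "r \<le> al (Suc m)" using s by (auto simp: closed_segment_eq_real_ivl split: if_splits)
    then show "u \<in> Om \<and> w (Suc m) \<le> bdist Om u"
      unfolding u(1) using cube_channel[OF i] by (intro bdist_ge_cube w_pos)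
  qed
  then show ?thesis using s by (simp add: dist_pt_t)
qed

lemma near_site:
  assumes "0 \<le> \<xi>" "\<xi> \<le> 1"
  shows "\<exists>i\<le>N m. \<bar>\<xi> - site m i\<bar> \<le> 1 / real (N m)"
proof -
  define i where "i = nat \<lfloor>\<xi> * real (N m)\<rfloor>"
  have ge: "0 \<le> \<xi> * real (N m)" using assms by simp
  have i: "real i \<le> \<xi> * real (N m)" "\<xi> * real (N m) < real i + 1"
    using ge by (auto simp: i_def)
  have "\<xi> * real (N m) \<le> 1 * real (N m)" using assms by (intro mult_right_mono) auto
  then have "i \<le> N m" using i by simp
  moreover have "\<bar>\<xi> - site m i\<bar> = \<bar>\<xi> * real (N m) - real i\<bar> / real (N m)"
    using N_pos[of m] by (simp add: site_def abs_divide[symmetric] field_simps)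
  then have "\<bar>\<xi> - site m i\<bar> \<le> 1 / real (N m)" using i N_pos[of m] by (simp add: divide_right_mono)
  ultimately show ?thesis by blast
qed

lemma P_nonneg: "0 \<le> P m"
  using w_pos[of 0] L_ge_1[of m] by (auto simp: P_def C1_def intro!: mult_nonneg_nonneg add_nonneg_nonneg)

text \<open>Induction on the level: slide to the nearest site, descend its channel to the middle of
  the hub below, and continue there.\<close>

lemma hub_to_base:
  assumes "qh_bound Om x (pt \<xi> (al m)) c" "0 \<le> c" "0 \<le> \<xi>" "\<xi> \<le> 1"
  shows "qh_bound Om x (pt 0 (al 0)) (c + P m)"
  using assms
proof (induction m arbitrary: \<xi> c)
  case 0
  have "qh_bound Om x (pt 0 (al 0)) (c + \<bar>\<xi> - 0\<bar> / w 0)"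
    using 0 by (intro move_along_hub) auto
  moreover have "\<bar>\<xi> - 0\<bar> / w 0 \<le> 1 / w 0" using 0 w_pos[of 0] by (intro divide_right_mono) auto
  ultimately show ?case using P_0 by (auto intro: qh_bound_mono)
next
  case (Suc m)
  obtain i where i: "i \<le> N (Suc m)" "\<bar>\<xi> - site (Suc m) i\<bar> \<le> 1 / real (N (Suc m))"
    using near_site Suc.prems by blast
  define c1 where "c1 = c + \<bar>\<xi> - site (Suc m) i\<bar> / w (Suc m)"
  define c2 where "c2 = c1 + (al (Suc m) - al m) / w (Suc m)"
  have c1: "0 \<le> c1" using Suc.prems w_pos[of "Suc m"] by (simp add: c1_def)
  have s: "0 \<le> site (Suc m) i" "site (Suc m) i \<le> 1" using site_bounds[OF i(1)] by auto
  have "qh_bound Om x (pt (site (Suc m) i) (al (Suc m))) c1"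
    unfolding c1_def using Suc.prems s by (intro move_along_hub)
  then have "qh_bound Om x (pt (site (Suc m) i) (al m)) c2"
    unfolding c2_def using c1 i(1) al_less_Suc[of m] by (intro move_along_channel) auto
  moreover have "0 \<le> c2" using c1 al_less_Suc[of m] w_pos[of "Suc m"] by (simp add: c2_def)
  ultimately have "qh_bound Om x (pt 0 (al 0)) (c2 + P m)" using s by (intro Suc.IH)
  moreover have "c2 + P m \<le> c + P (Suc m)"
  proof -
    have "\<bar>\<xi> - site (Suc m) i\<bar> / w (Suc m) \<le> 1 / real (N (Suc m)) / w (Suc m)"
      using i(2) w_pos[of "Suc m"] by (intro divide_right_mono) auto
    then have "\<bar>\<xi> - site (Suc m) i\<bar> / w (Suc m) \<le> 8 * real (J (Suc m))" by (simp only: N_w)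
    then show ?thesis using climb_cost[of m] P_step[of m] by (simp add: c2_def c1_def)
  qed
  ultimately show ?case by (rule qh_bound_mono)
qed

text \<open>\<open>w m\<close> is the half-width of the hub containing \<open>x\<close>, or of the
  channel if \<open>x\<close> lies between hubs. \<open>qh_bound_star\<close> leads from
  \<open>x\<close> to the central axis and \<open>hub_to_base\<close> does the rest.\<close>

lemma Om_level:
  assumes x: "x \<in> Om"
  shows "\<exists>m. bdist Om x \<le> 2 * w m \<and>
    qh_bound Om x (pt 0 (al 0)) (2 * real n * ln (1 + (real n + 1) * w m / bdist Om x) + P m)"
proof -
  have star: "qh_bound Om x c (2 * real n * ln (1 + (real n + 1) * r / bdist Om x))"
    if "x \<in> cube c r" "cube c r \<subseteq> Om" "0 < r" for c r
    using qh_bound_star[OF bounded_Om open_Om convex_cube that(2,1) ball_subset_cube that(3)] dist_cube[OF that(1)] n_card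
    by simp
  have nonneg: "0 \<le> 2 * real n * ln (1 + (real n + 1) * w m / bdist Om x)" for m
    using w_pos[of m] by (intro mult_nonneg_nonneg ln_ge_zero) (auto simp: bdist_def infdist_nonneg)
  have hub: ?thesis if h: "x \<in> hub m" for m
  proof -
    \<comment> \<open>Clamping takes care of the overhangs, whose points lie in the cube about an
      end point of the axis.\<close>
    define \<xi> where "\<xi> = max 0 (min 1 (x $ e))"
    have \<xi>: "0 \<le> \<xi>" "\<xi> \<le> 1" by (auto simp: \<xi>_def)
    have cu: "x \<in> cube (pt \<xi> (al m)) (w m)"
      using h w_pos[of m] by (auto simp: cube_pt hub_def al_def \<xi>_def abs_less_iff)
    have "qh_bound Om x (pt \<xi> (al m)) (2 * real n * ln (1 + (real n + 1) * w m / bdist Om x))"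
      using cube_hub[OF \<xi>] hub_subset by (intro star cu w_pos) blast
    from hub_to_base[OF this nonneg \<xi>] show ?thesis
      using bdist_le_side[OF x, of "w m"] side_less_hub[of _ m] h by (intro exI[of _ m]) (auto simp: hub_def)
  qed
  show ?thesis using x
  proof (cases rule: Om_cases)
    case (hub m)
    then show ?thesis using \<open>\<And>m. x \<in> hub m \<Longrightarrow> ?thesis\<close> by blast
  next
    case (channel m i)
    note ch = channel(2)[unfolded channel_def mem_Collect_eq]
    have st: "0 \<le> site (Suc m) i" "site (Suc m) i \<le> 1" using site_bounds[OF channel(1)] by auto
    \<comment> \<open>The ends of a channel are treated as hub points; in the lower one the width of
      \<open>Om\<close> is that of the hub.\<close>
    consider "x $ t < b m + 2 * w m" | "b (Suc m) < x $ t" | "b m + 2 * w m \<le> x $ t" "x $ t \<le> b (Suc m)" by linarith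
    then show ?thesis
    proof cases
      case 1
      have "x \<in> hub m" using ch 1 st w_Suc_le[of m] w_pos[of m]
        by (auto simp: hub_def al_def abs_less_iff intro: less_le_trans dest!: spec)
      then show ?thesis by (rule hub)
    next
      case 2
      have "x \<in> hub (Suc m)" using ch 2 st w_pos[of "Suc m"]
        by (auto simp: hub_def al_def abs_less_iff simp del: b.simps(2) dest!: spec)
      then show ?thesis by (rule hub)
    next
      case 3
      define c where "c = 2 * real n * ln (1 + (real n + 1) * w (Suc m) / bdist Om x)"
      define c2 where "c2 = c + (x $ t - al m) / w (Suc m)"
      have s: "al m \<le> x $ t" "x $ t \<le> al (Suc m)" using ch by auto
      have "x \<in> cube (pt (site (Suc m) i) (x $ t)) (w (Suc m))" using ch w_pos[of "Suc m"] by (auto simp: cube_pt)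
      then have "qh_bound Om x (pt (site (Suc m) i) (x $ t)) c"
        unfolding c_def using cube_channel[OF channel(1) s] by (intro star w_pos)
      then have "qh_bound Om x (pt (site (Suc m) i) (al m)) c2"
        unfolding c2_def using nonneg channel(1) s by (intro move_along_channel) (auto simp: c_def)
      moreover have "0 \<le> c2" using nonneg[of "Suc m"] s w_pos[of "Suc m"] by (simp add: c2_def c_def)
      ultimately have "qh_bound Om x (pt 0 (al 0)) (c2 + P m)" using st by (intro hub_to_base)
      moreover have "c2 + P m \<le> c + P (Suc m)"
      proof -
        have "(x $ t - al m) / w (Suc m) \<le> (al (Suc m) - al m) / w (Suc m)"
          using s w_pos[of "Suc m"] by (intro divide_right_mono) auto
        then show ?thesis using climb_cost[of m] P_step[of m] by (simp add: c2_def)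
      qed
      ultimately have "qh_bound Om x (pt 0 (al 0)) (c + P (Suc m))" by (rule qh_bound_mono)
      moreover have "bdist Om x \<le> 2 * w (Suc m)"
        using side_less_channel[of _ m] 3 by (intro bdist_le_side[OF x]) auto
      ultimately show ?thesis unfolding c_def by blast
    qed
  qed
qed

lemma base_in_Om: "pt 0 (al 0) \<in> Om"
  using cube_hub[of 0 0] hub_subset[of 0] w_pos[of 0] bdist_ge_cube[of "pt 0 (al 0)" "w 0"] by auto

lemma domain_Om: "is_domain Om"
  unfolding is_domain_def
proof (intro conjI)
  show "Om \<noteq> {}" using base_in_Om by auto
  have *: "path_component Om x (pt 0 (al 0))" if "x \<in> Om" for x
    using Om_level[OF that] qh_bound_imp_path unfolding path_component_def by fast
  have "path_connected Om"
    unfolding path_connected_component using * path_component_trans path_component_sym by metis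
  then show "connected Om" by (rule path_connected_imp_connected)
qed (rule open_Om)

lemma quasihyperbolic_growth:
  assumes "x \<in> Om"
  shows "enn2ereal (quasihyperbolic_dist Om x (pt 0 (al 0)))
    \<le> ereal (C * bdist Om x powr (- (1 / real n)) * ln (C / bdist Om x))"
proof -
  obtain m where m: "bdist Om x \<le> 2 * w m"
    "qh_bound Om x (pt 0 (al 0)) (2 * real n * ln (1 + (real n + 1) * w m / bdist Om x) + P m)"
    using Om_level[OF assms] by blast
  obtain r where "0 < r" "ball x r \<subseteq> Om" using open_Om assms openE by blast
  then have "0 < bdist Om x" using bdist_ge[OF bounded_Om open_Om, of x r] by simp
  note g = growth_bound[OF this m(1)]
  define c where "c = 2 * real n * ln (1 + (real n + 1) * w m / bdist Om x) + P m"
  have c: "0 \<le> c" unfolding c_def using w_pos[of m] P_nonneg[of m]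
    by (intro add_nonneg_nonneg mult_nonneg_nonneg ln_ge_zero) (auto simp: bdist_def infdist_nonneg)
  have "quasihyperbolic_dist Om x (pt 0 (al 0)) \<le> ennreal c"
    using qh_bound_imp_dist_le[OF m(2)] by (simp add: c_def)
  then have "enn2ereal (quasihyperbolic_dist Om x (pt 0 (al 0))) \<le> enn2ereal (ennreal c)"
    by (simp add: less_eq_ennreal.rep_eq)
  also have "\<dots> = ereal c" using c by (simp add: enn2ereal_ennreal)
  also have "\<dots> \<le> ereal (C * bdist Om x powr (- (1 / real n)) * ln (C / bdist Om x))"
    using g by (simp add: c_def)
  finally show ?thesis .
qed

end


section \<open>The quasiconformal map\<close>

lemma det_scale_shear:
  fixes u :: "real^'n::finite"
  assumes "u $ k = 0"
  shows "det (matrix (\<lambda>v. s *\<^sub>R v + v $ k *\<^sub>R u)) = s ^ CARD('n)"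
proof (cases "s = 0")
  case True
  have "row k (matrix (\<lambda>v. s *\<^sub>R v + v $ k *\<^sub>R u)) = 0"
    using assms True by (simp add: row_def matrix_def vec_eq_iff)
  then show ?thesis using True by (simp add: det_zero_row(2))
next
  case False
  define A where "A = (matrix ((*\<^sub>R) s) :: real^'n^'n)"
  \<comment> \<open>Column \<open>k\<close> of the matrix is \<open>A *v x\<close>, so Cramer's rule
    gives its determinant as \<open>x $ k\<close> times that of \<open>A\<close>.\<close>
  define x where "x = axis k 1 + u /\<^sub>R s"
  have A: "A $ i $ j = (if i = j then s else 0)" for i j by (simp add: A_def matrix_def axis_def)
  have "(A *v x) $ i = s * x $ i" for i
  proof -
    have "(A *v x) $ i = (\<Sum>j\<in>UNIV. if i = j then s * x $ j else 0)"
      unfolding matrix_vector_mult_def vec_lambda_beta A by (rule sum.cong) auto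
    then show ?thesis by simp
  qed
  then have "A *v x = s *\<^sub>R x" by (simp add: vec_eq_iff)
  then have Ax: "A *v x = s *\<^sub>R axis k 1 + u" using False by (simp add: x_def scaleR_add_right)
  have "(\<chi> i j. if j = k then (A *v x) $ i else A $ i $ j) = matrix (\<lambda>v. s *\<^sub>R v + v $ k *\<^sub>R u)"
    unfolding Ax using A by (auto simp: matrix_def vec_eq_iff axis_def)
  then have "det (matrix (\<lambda>v. s *\<^sub>R v + v $ k *\<^sub>R u)) = x $ k * det A"
    using cramer_lemma[of k A x] by simp
  also have "x $ k = 1" using assms by (simp add: x_def)
  also have "det A = s ^ CARD('n)" unfolding A_def by (rule det_matrix_scaleR)
  finally show ?thesis by simp
qed

lemma digits_eq_imp_mod_eq:
  fixes i i' B :: nat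
  assumes "\<And>p. p < q \<Longrightarrow> (i div B ^ p) mod B = (i' div B ^ p) mod B"
  shows "i mod B ^ q = i' mod B ^ q"
  using assms
proof (induction q)
  case (Suc q)
  have "k mod B ^ Suc q = B ^ q * ((k div B ^ q) mod B) + k mod B ^ q" for k
    using mod_mult2_eq[of k "B ^ q" B] by (simp add: mult.commute)
  then show ?case using Suc.IH Suc.prems by simp
qed simp

lemma mod_eq_imp_far:
  fixes i i' q :: nat
  assumes "i mod q = i' mod q" "i \<noteq> i'"
  shows "real q \<le> \<bar>real i - real i'\<bar>"
proof -
  have *: "real q \<le> real j - real k" if "k < j" "j mod q = k mod q" for j k
  proof -
    have "q dvd j - k" using that mod_eq_dvd_iff_nat[of k j q] by simp
    then have "q \<le> j - k" using that by (intro dvd_imp_le) auto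
    then have "real q \<le> real (j - k)" by (simp only: of_nat_le_iff)
    then show ?thesis using that by (simp add: of_nat_diff)
  qed
  show ?thesis using *[of i i'] *[of i' i] assms by (cases "i < i'") auto
qed

section \<open>The explicit map and its injectivity\<close>

context channels
begin

definition lam :: "nat \<Rightarrow> real" where "lam m = (1/2) ^ m"

definition zz :: "nat \<Rightarrow> real \<Rightarrow> real" where "zz m s = (s - (b m + 2 * w m)) / run (Suc m)"

definition sg :: "nat \<Rightarrow> real \<Rightarrow> real" where "sg m s = lam m * stretch (M (Suc m)) (zz m s)"
definition sp :: "nat \<Rightarrow> real \<Rightarrow> real" where "sp m s = lam m * spread (M (Suc m)) (zz m s)"
text \<open>The factor \<open>4 * w * M\<close> equals \<open>2 / J\<close>, so the \<open>J\<close>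
  digits spread over a range of order \<open>lam m\<close>. In the second case of
  \<open>spread_or_fan\<close>, one unit of a digit then moves a channel by at least its own
  width.\<close>

definition fn :: "nat \<Rightarrow> real \<Rightarrow> real" where
  "fn m s = 4 * w (Suc m) * M (Suc m) * lam m * fan (M (Suc m)) (zz m s)"

text \<open>The antiderivative of the scale starts below \<open>b m\<close> so that it is differentiable on an open
  interval containing all the heights where it is used.\<close>

definition primit :: "nat \<Rightarrow> real \<Rightarrow> real" where "primit m s = integral {b m - 1..s} (sg m)"

primrec hb :: "nat \<Rightarrow> real" where
  "hb 0 = 0"
| "hb (Suc m) = hb m + (primit m (b (Suc m)) - primit m (b m))"

definition height :: "nat \<Rightarrow> real \<Rightarrow> real" where "height m s = hb m + (primit m s - primit m (b m))"

definition digit :: "nat \<Rightarrow> 'n \<Rightarrow> nat \<Rightarrow> nat" where "digit m k i = (i div J m ^ pos k) mod J m"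

text \<open>The centre of the channel goes to the position given by \<open>sp\<close> times the site
  and \<open>fn\<close> times the digits; the cross-section is scaled about it by
  \<open>sg\<close>.\<close>

definition chmap :: "nat \<Rightarrow> nat \<Rightarrow> real^'n \<Rightarrow> real^'n" where
  "chmap m i y = (\<chi> j. if j = t then height m (y $ t)
     else if j = e then sg m (y $ t) * (y $ e - site (Suc m) i) + sp m (y $ t) * site (Suc m) i
     else sg m (y $ t) * y $ j + fn m (y $ t) * real (digit (Suc m) j i))"

definition hubmap :: "nat \<Rightarrow> real^'n \<Rightarrow> real^'n" where
  "hubmap m y = (\<chi> j. if j = t then hb m + lam m * (y $ t - b m) else lam m * y $ j)"

definition stage :: "real \<Rightarrow> nat" where "stage s = (LEAST m. s < b (Suc m))"

text \<open>Rounding finds the number of the channel; inside a hub its value is irrelevant by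
  \<open>chmap_low\<close>. \<open>G\<close> leads from \<open>Om\<close> to the new domain, and its
  inverse will be the quasiconformal map.\<close>

definition G :: "real^'n \<Rightarrow> real^'n" where
  "G y = chmap (stage (y $ t)) (nat (round (y $ e * real (N (Suc (stage (y $ t))))))) y"

lemma lam_pos: "0 < lam m" by (simp add: lam_def)
lemma lam_Suc: "lam (Suc m) = lam m / 2" by (simp add: lam_def)
lemma lam_antimono: "k \<le> m \<Longrightarrow> lam m \<le> lam k" unfolding lam_def by (intro power_decreasing) auto

lemma zz_le_0: "s \<le> b m + 2 * w m \<Longrightarrow> zz m s \<le> 0"
  using run_pos[of "Suc m"] by (simp add: zz_def divide_nonpos_pos)

lemma zz_ge_2: "b (Suc m) \<le> s \<Longrightarrow> 2 \<le> zz m s"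
  using run_pos[of "Suc m"] by (simp add: zz_def pos_le_divide_eq)

lemma profile_low:
  assumes "s \<le> b m + 2 * w m"
  shows "sg m s = lam m" "sp m s = lam m" "fn m s = 0"
  using zz_le_0[OF assms] M_ge_2[of "Suc m"]
  by (auto simp: sg_def sp_def fn_def stretch_le_0 spread_le_0 fan_le_0)

lemma profile_high:
  assumes "b (Suc m) \<le> s"
  shows "sg m s = lam (Suc m)" "sp m s = lam (Suc m)" "fn m s = 0"
  using zz_ge_2[OF assms] M_ge_2[of "Suc m"]
  by (auto simp: sg_def sp_def fn_def lam_Suc stretch_ge_2 spread_ge_2 fan_ge_2)

lemma sg_pos: "0 < sg m s"
  using stretch_pos[of "M (Suc m)" "zz m s"] lam_pos[of m] M_ge_2[of "Suc m"] by (simp add: sg_def)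

lemma sg_ge: "lam (Suc m) \<le> sg m s"
  using stretch_ge_half[of "M (Suc m)" "zz m s"] lam_pos[of m] M_ge_2[of "Suc m"]
  by (simp add: sg_def lam_Suc)

lemma DERIV_zz: "(zz m has_real_derivative 1 / run (Suc m)) (at s)"
  unfolding zz_def[abs_def] using run_pos[of "Suc m"] by (auto intro!: derivative_eq_intros)

lemma w_J_M: "w m * real (J m) * M m = 1/2"
  using J_w[of m] M_ge_2[of m] by (simp add: field_simps)

text \<open>As \<open>run = J * w * Lam\<close>, passing to the true height cancels the logarithm in
  the derivative bounds.\<close>

lemma profile_chain:
  assumes "(f has_real_derivative d) (at (zz m s))" "\<bar>d\<bar> \<le> c * Lam (Suc m) * r"
  shows "((\<lambda>s. f (zz m s)) has_real_derivative d / run (Suc m)) (at s)"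
    and "\<bar>d / run (Suc m)\<bar> \<le> c * r / (w (Suc m) * real (J (Suc m)))"
proof -
  show "((\<lambda>s. f (zz m s)) has_real_derivative d / run (Suc m)) (at s)"
    using DERIV_chain2[OF assms(1) DERIV_zz] by simp
  have "\<bar>d / run (Suc m)\<bar> = \<bar>d\<bar> / run (Suc m)" using run_pos[of "Suc m"] by simp
  also have "\<dots> \<le> c * Lam (Suc m) * r / run (Suc m)"
    using assms(2) run_pos[of "Suc m"] by (intro divide_right_mono) auto
  also have "\<dots> = c * r / (w (Suc m) * real (J (Suc m)))"
    using Lam_pos[of "Suc m"] by (simp add: run_def)
  finally show "\<bar>d / run (Suc m)\<bar> \<le> c * r / (w (Suc m) * real (J (Suc m)))" .
qed

text \<open>Here and in the next two lemmas the derivative is weighted by the size of what it acts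
  on: \<open>w\<close> for a cross-section, 1 for a site, \<open>J\<close> for a digit. Each product
  is at most a multiple of the scale, which bounds the shear.\<close>

lemma sg_derivative:
  "\<exists>d. (sg m has_real_derivative d) (at s) \<and> \<bar>d\<bar> * w (Suc m) \<le> 4 * sg m s"
proof -
  obtain d where d: "(stretch (M (Suc m)) has_real_derivative d) (at (zz m s))"
    "\<bar>d\<bar> \<le> 4 * Lam (Suc m) * stretch (M (Suc m)) (zz m s)"
    using stretch_derivative[OF M_ge_2] unfolding Lam_def by blast
  note c = profile_chain[OF d]
  define d' where "d' = d / run (Suc m)"
  have "(sg m has_real_derivative lam m * d') (at s)"
    unfolding sg_def[abs_def] d'_def by (intro DERIV_cmult c(1))
  moreover have "\<bar>lam m * d'\<bar> * w (Suc m) \<le> 4 * sg m s"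
  proof -
    have p: "0 < w (Suc m)" "1 \<le> real (J (Suc m))" using w_pos J_ge_2[of "Suc m"] by auto
    have st: "0 < stretch (M (Suc m)) (zz m s)" using stretch_pos[OF M_ge_2] .
    have "\<bar>d'\<bar> * w (Suc m) \<le> 4 * stretch (M (Suc m)) (zz m s) / (w (Suc m) * real (J (Suc m))) * w (Suc m)"
      using c(2) p by (intro mult_right_mono) (auto simp: d'_def)
    also have "\<dots> = 4 * stretch (M (Suc m)) (zz m s) / real (J (Suc m))" using p by simp
    also have "\<dots> \<le> 4 * stretch (M (Suc m)) (zz m s) / 1" using p st by (intro divide_left_mono) auto
    finally have "lam m * (\<bar>d'\<bar> * w (Suc m)) \<le> lam m * (4 * stretch (M (Suc m)) (zz m s))"
      using lam_pos[of m] by (intro mult_left_mono) auto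
    then show ?thesis using lam_pos[of m] by (simp add: abs_mult sg_def ac_simps)
  qed
  ultimately show ?thesis by blast
qed

lemma sp_derivative:
  "\<exists>d. (sp m has_real_derivative d) (at s) \<and> \<bar>d\<bar> \<le> 4 * sg m s"
proof -
  obtain d where d: "(spread (M (Suc m)) has_real_derivative d) (at (zz m s))"
    "\<bar>d\<bar> \<le> 2 * Lam (Suc m) * (stretch (M (Suc m)) (zz m s) / M (Suc m))"
    using spread_derivative[OF M_ge_2] unfolding Lam_def by (metis times_divide_eq_right)
  note c = profile_chain[OF d]
  define d' where "d' = d / run (Suc m)"
  have "(sp m has_real_derivative lam m * d') (at s)"
    unfolding sp_def[abs_def] d'_def by (intro DERIV_cmult c(1))
  moreover have "\<bar>lam m * d'\<bar> \<le> 4 * sg m s"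
  proof -
    have "\<bar>d'\<bar> \<le> 2 * stretch (M (Suc m)) (zz m s) / (w (Suc m) * real (J (Suc m)) * M (Suc m))"
      using c(2) by (simp add: d'_def ac_simps)
    also have "\<dots> = 4 * stretch (M (Suc m)) (zz m s)" by (simp add: w_J_M)
    finally have "lam m * \<bar>d'\<bar> \<le> lam m * (4 * stretch (M (Suc m)) (zz m s))"
      using lam_pos[of m] by (intro mult_left_mono) auto
    then show ?thesis using lam_pos[of m] by (simp add: abs_mult sg_def ac_simps)
  qed
  ultimately show ?thesis by blast
qed

lemma fn_derivative:
  "\<exists>d. (fn m has_real_derivative d) (at s) \<and> \<bar>d\<bar> * real (J (Suc m)) \<le> 16 * sg m s"
proof -
  obtain d where d: "(fan (M (Suc m)) has_real_derivative d) (at (zz m s))"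
    "\<bar>d\<bar> \<le> 4 * Lam (Suc m) * (stretch (M (Suc m)) (zz m s) / M (Suc m))"
    using fan_derivative[OF M_ge_2] unfolding Lam_def by (metis times_divide_eq_right)
  note c = profile_chain[OF d]
  define d' where "d' = d / run (Suc m)"
  define k where "k = 4 * w (Suc m) * M (Suc m) * lam m"
  have p: "0 < w (Suc m)" "0 < real (J (Suc m))" "0 < M (Suc m)" "0 < lam m"
    using w_pos[of "Suc m"] J_ge_2[of "Suc m"] M_ge_2[of "Suc m"] lam_pos[of m] by auto
  then have k: "0 < k" by (simp add: k_def)
  have "(fn m has_real_derivative k * d') (at s)"
    unfolding fn_def[abs_def] d'_def k_def by (intro DERIV_cmult c(1))
  moreover have "\<bar>k * d'\<bar> * real (J (Suc m)) \<le> 16 * sg m s"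
  proof -
    have "\<bar>d'\<bar> \<le> 4 * stretch (M (Suc m)) (zz m s) / (w (Suc m) * real (J (Suc m)) * M (Suc m))"
      using c(2) by (simp add: d'_def ac_simps)
    then have "(k * real (J (Suc m))) * \<bar>d'\<bar> \<le> (k * real (J (Suc m))) *
        (4 * stretch (M (Suc m)) (zz m s) / (w (Suc m) * real (J (Suc m)) * M (Suc m)))"
      using k p by (intro mult_left_mono) auto
    also have "\<dots> = 16 * sg m s" using p by (simp add: k_def sg_def)
    finally show ?thesis using k by (simp add: abs_mult ac_simps)
  qed
  ultimately show ?thesis by blast
qed

lemma continuous_sg: "continuous_on S (sg m)"
  using sg_derivative DERIV_isCont by (intro continuous_at_imp_continuous_on) blast

lemma DERIV_height:
  assumes "b m - 1 < s"
  shows "(height m has_real_derivative sg m s) (at s)"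
proof -
  have "((\<lambda>x. integral {b m - 1..x} (sg m)) has_real_derivative sg m s) (at s within {b m - 1..s + 1})"
    using assms by (intro integral_has_real_derivative continuous_sg) auto
  then have "(primit m has_real_derivative sg m s) (at s within {b m - 1..s + 1})"
    by (simp add: primit_def[abs_def])
  moreover have "s \<in> interior {b m - 1..s + 1}" using assms by simp
  ultimately have "(primit m has_real_derivative sg m s) (at s)" by (metis at_within_interior)
  then show ?thesis unfolding height_def[abs_def] by (auto intro!: derivative_eq_intros)
qed

lemma height_less: "b m - 1 < s \<Longrightarrow> s < s' \<Longrightarrow> height m s < height m s'"
proof (rule DERIV_pos_imp_increasing[of s s' "height m"])
  fix x assume "b m - 1 < s" "s \<le> x"
  then have "b m - 1 < x" by simp
  then show "\<exists>d. (height m has_real_derivative d) (at x) \<and> 0 < d" using DERIV_height sg_pos by blast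
qed

lemma height_affine:
  assumes "b m - 1 < s" "s \<le> s'" "\<And>x. s \<le> x \<Longrightarrow> x \<le> s' \<Longrightarrow> sg m x = c"
  shows "height m s' - height m s = c * (s' - s)"
proof (cases "s = s'")
  case False
  then have "s < s'" using assms by simp
  then obtain z where "s < z" "z < s'" "height m s' - height m s = (s' - s) * sg m z"
    using MVT2[of s s' "height m" "sg m"] DERIV_height assms(1) by (metis less_le_trans)
  then show ?thesis using assms(3)[of z] by simp
qed simp

lemma height_base: "height m (b m) = hb m" "height m (b (Suc m)) = hb (Suc m)"
  by (auto simp: height_def)

text \<open>At the heights of a hub the profiles are constant and the channel number cancels. With
  \<open>chmap_high\<close> this makes all formulas agree on overlaps.\<close>

lemma chmap_low:
  assumes "b m \<le> y $ t" "y $ t \<le> b m + 2 * w m"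
  shows "chmap m i y = hubmap m y"
proof -
  have "height m (y $ t) - height m (b m) = lam m * (y $ t - b m)"
    by (rule height_affine) (use assms profile_low in auto)
  then show ?thesis using profile_low[OF assms(2)]
    by (auto simp: chmap_def hubmap_def vec_eq_iff height_base algebra_simps)
qed

lemma chmap_high:
  assumes "b (Suc m) \<le> y $ t"
  shows "chmap m i y = hubmap (Suc m) y"
proof -
  have "height m (y $ t) - height m (b (Suc m)) = lam (Suc m) * (y $ t - b (Suc m))"
    by (rule height_affine) (use assms profile_high b_mono[of m "Suc m"] in \<open>auto simp del: b.simps(2)\<close>)
  then show ?thesis using profile_high[OF assms]
    by (auto simp: chmap_def hubmap_def vec_eq_iff height_base algebra_simps simp del: b.simps(2) hb.simps(2))
qed

lemma stage_eq:
  assumes "b m \<le> s" "s < b (Suc m)"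
  shows "stage s = m"
  unfolding stage_def
proof (rule Least_equality)
  show "s < b (Suc m)" by fact
  fix k assume "s < b (Suc k)"
  then have "\<not> Suc k \<le> m" using b_mono[of "Suc k" m] assms(1) by linarith
  then show "m \<le> k" by simp
qed

lemma G_hub:
  assumes "y \<in> hub m"
  shows "G y = hubmap m y"
proof -
  have h: "b m < y $ t" "y $ t < b m + 2 * w m" using assms by (auto simp: hub_def)
  then have "stage (y $ t) = m" using b_less_Suc[of m] by (intro stage_eq) linarith+
  then show ?thesis unfolding G_def using h by (auto intro: chmap_low)
qed

lemma G_channel:
  assumes "y \<in> channel m i"
  shows "G y = chmap m i y"
proof -
  have h: "al m < y $ t" "y $ t < al (Suc m)" and x: "\<bar>y $ e - site (Suc m) i\<bar> < w (Suc m)"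
    using assms by (auto simp: channel_def)
  have bm: "b m < y $ t" using h w_pos[of m] by (simp add: al_def)
  show ?thesis
  proof (cases "y $ t < b (Suc m)")
    case True
    then have st: "stage (y $ t) = m" using bm by (intro stage_eq) auto
    \<comment> \<open>Rounding returns \<open>i\<close> because the offset is less than
      \<open>w * N\<close>, which is at most 1/4.\<close>
    have "y $ e * real (N (Suc m)) - real i = (y $ e - site (Suc m) i) * real (N (Suc m))"
      using N_pos[of "Suc m"] by (simp add: site_def left_diff_distrib)
    then have "\<bar>y $ e * real (N (Suc m)) - real i\<bar> = \<bar>y $ e - site (Suc m) i\<bar> * real (N (Suc m))"
      by (simp add: abs_mult)
    also have "\<dots> < w (Suc m) * real (N (Suc m))" using x N_pos[of "Suc m"] by (intro mult_strict_right_mono) auto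
    also have "\<dots> < 1/2" using w_le_N[of "Suc m"] by simp
    finally have "round (y $ e * real (N (Suc m))) = int i" by (intro round_unique') auto
    then show ?thesis by (simp add: G_def st)
  next
    \<comment> \<open>The stage is now \<open>Suc m\<close>, but both formulas reduce to
      \<open>hubmap (Suc m)\<close>.\<close>
    case False
    then have "b (Suc m) \<le> y $ t" by simp
    moreover have "y $ t < b (Suc m) + 2 * w (Suc m)" using h w_pos[of "Suc m"] by (simp add: al_def)
    moreover then have "y $ t < b (Suc (Suc m))" using b_less_Suc[of "Suc m"] by linarith
    ultimately show ?thesis unfolding G_def
      using stage_eq[of "Suc m" "y $ t"] chmap_low[of "Suc m" y] chmap_high[of m y] by simp
  qed
qed

lemma hb_mono: "k \<le> m \<Longrightarrow> hb k \<le> hb m"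
proof (rule lift_Suc_mono_le[of hb])
  fix m show "hb m \<le> hb (Suc m)"
    using height_less[of m "b m" "b (Suc m)"] b_strict_mono[of m "Suc m"] unfolding height_base by simp
qed auto

lemma stage_exists:
  assumes "y \<in> Om"
  shows "\<exists>m. b m \<le> y $ t \<and> y $ t < b (Suc m)"
proof -
  have "\<exists>k. y $ t < b k" using assms
  proof (cases rule: Om_cases)
    case (hub m)
    then have "y $ t < b (Suc m)" using b_less_Suc[of m] by (auto simp: hub_def simp del: b.simps(2))
    then show ?thesis by blast
  next
    case (channel m i)
    then have "y $ t < b (Suc (Suc m))" using b_less_Suc[of "Suc m"] w_pos[of "Suc m"]
      by (auto simp: channel_def al_def simp del: b.simps(2))
    then show ?thesis by blast
  qed
  then obtain k where k: "y $ t < b k" "\<And>j. j < k \<Longrightarrow> \<not> y $ t < b j" using exists_least_iff[of "\<lambda>k. y $ t < b k"] by blast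
  have "0 < y $ t" using height_bounds[OF assms] by simp
  then obtain m where "k = Suc m" using k(1) by (cases k) auto
  then show ?thesis using k(1) k(2)[of m] by (intro exI[of _ m]) (auto simp del: b.simps(2))
qed

lemma G_stage:
  assumes "b m \<le> y $ t" "y $ t < b (Suc m)"
  shows "G y $ t = height m (y $ t)"
  by (simp add: G_def stage_eq[OF assms] chmap_def)

text \<open>Equal images force the centres of two image channels to differ by less than
  \<open>2 * r\<close>, their common width, in each coordinate. Either the spacing along
  \<open>e\<close> excludes this, or all digits agree and the sites are far apart.\<close>

lemma channels_disjoint:
  assumes y: "y \<in> channel m i" and y': "y' \<in> channel m i'" and t: "y $ t = y' $ t"
    and eq: "chmap m i y = chmap m i' y'"
  shows "i = i'"
proof (rule ccontr)
  assume ne: "i \<noteq> i'"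
  define s where "s = y $ t"
  define r where "r = sg m s * w (Suc m)"
  let ?M = "M (Suc m)" and ?J = "real (J (Suc m))" and ?N = "real (N (Suc m))" and ?w = "w (Suc m)"
  have M: "2 \<le> ?M" by (rule M_ge_2)
  have p: "0 < ?w" "0 < ?J" "0 < ?N" using w_pos J_pos N_pos by auto
  have e1: "sg m s * (y $ e - site (Suc m) i) + sp m s * site (Suc m) i
      = sg m s * (y' $ e - site (Suc m) i') + sp m s * site (Suc m) i'"
    using arg_cong[OF eq, of "\<lambda>v. v $ e"] et t by (simp add: chmap_def s_def)
  have k1: "sg m s * y $ k + fn m s * real (digit (Suc m) k i) = sg m s * y' $ k + fn m s * real (digit (Suc m) k i')"
    if "k \<noteq> e" "k \<noteq> t" for k
    using arg_cong[OF eq, of "\<lambda>v. v $ k"] that t by (simp add: chmap_def s_def)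
  have near: "\<bar>sg m s * a - sg m s * a'\<bar> < 2 * r" if "\<bar>a\<bar> < ?w" "\<bar>a'\<bar> < ?w" for a a'
  proof -
    have "\<bar>sg m s * a - sg m s * a'\<bar> = sg m s * \<bar>a - a'\<bar>"
      using sg_pos[of m s] by (simp add: right_diff_distrib[symmetric] abs_mult)
    also have "\<dots> < sg m s * (2 * ?w)" using that sg_pos[of m s] by (intro mult_strict_left_mono) auto
    finally show ?thesis by (simp add: r_def)
  qed
  have sp0: "0 < sp m s" and sgM: "sg m s \<le> ?M * sp m s"
  proof -
    have "lam m * stretch ?M (zz m s) \<le> lam m * (?M * spread ?M (zz m s))"
      using stretch_le_spread[OF M] lam_pos[of m] by (intro mult_left_mono) auto
    then show *: "sg m s \<le> ?M * sp m s" by (simp add: sg_def sp_def ac_simps)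
    show "0 < sp m s" using sg_pos[of m s] * M by (metis less_le_trans zero_less_mult_pos zero_less_numeral)
  qed
  have e2: "sp m s * (\<bar>real i - real i'\<bar> / ?N) < 2 * r"
  proof -
    have "\<bar>sg m s * (y' $ e - site (Suc m) i') - sg m s * (y $ e - site (Suc m) i)\<bar> < 2 * r"
      using y y' by (intro near) (auto simp: channel_def)
    moreover have "sg m s * (y' $ e - site (Suc m) i') - sg m s * (y $ e - site (Suc m) i)
       = sp m s * ((real i - real i') / ?N)"
      using e1 by (simp add: site_def diff_divide_distrib right_diff_distrib)
    ultimately show ?thesis using sp0 by (simp add: abs_mult)
  qed
  have k2: "fn m s * \<bar>real (digit (Suc m) k i) - real (digit (Suc m) k i')\<bar> < 2 * r" if k: "k \<noteq> e" "k \<noteq> t" for k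
  proof -
    have "\<bar>sg m s * y' $ k - sg m s * y $ k\<bar> < 2 * r"
      using y y' k by (intro near) (auto simp: channel_def)
    moreover have "sg m s * y' $ k - sg m s * y $ k = fn m s * (real (digit (Suc m) k i) - real (digit (Suc m) k i'))"
      using k1[OF k] by (simp add: right_diff_distrib)
    moreover have "0 \<le> fn m s"
      unfolding fn_def fan_def using p M lam_pos[of m] widen_bounds(1)[OF M] fade_nonneg[OF M] by simp
    ultimately show ?thesis by (simp add: abs_mult)
  qed
  have r: "0 < r" using sg_pos[of m s] p by (simp add: r_def)
  consider "sg m s \<le> 2 * sp m s" | "2 * r \<le> fn m s"
  proof -
    consider "stretch ?M (zz m s) \<le> 2 * spread ?M (zz m s)" | "stretch ?M (zz m s) \<le> 2 * ?M * fan ?M (zz m s)"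
      using spread_or_fan[OF M] by blast
    then show thesis
    proof cases
      case 1
      then have "lam m * stretch ?M (zz m s) \<le> lam m * (2 * spread ?M (zz m s))"
        using lam_pos[of m] by (intro mult_left_mono) auto
      then show thesis using that(1) by (simp add: sg_def sp_def ac_simps)
    next
      case 2
      then have "(2 * ?w * lam m) * stretch ?M (zz m s) \<le> (2 * ?w * lam m) * (2 * ?M * fan ?M (zz m s))"
        using lam_pos[of m] p by (intro mult_left_mono) auto
      then show thesis using that(2) by (simp add: r_def sg_def fn_def ac_simps)
    qed
  qed
  then show False
  proof cases
    case 1
    have "1 \<le> \<bar>real i - real i'\<bar>" using mod_eq_imp_far[of i 1 i'] ne by simp
    then have "sp m s * (1 / ?N) \<le> sp m s * (\<bar>real i - real i'\<bar> / ?N)"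
      using sp0 p by (intro mult_left_mono divide_right_mono) auto
    also note e2
    also have "2 * r \<le> 2 * (2 * sp m s * ?w)" using 1 p unfolding r_def by (intro mult_left_mono mult_right_mono) auto
    finally have "sp m s * (1 / ?N) < sp m s * (4 * ?w)" by (simp add: ac_simps)
    then have "1 / ?N < 4 * ?w" using mult_less_cancel_left_pos[OF sp0] by blast
    then have "1 < 4 * ?w * ?N" using p by (simp add: field_simps)
    then show False using w_le_N[of "Suc m"] by simp
  next
    case 2
    have dig: "digit (Suc m) k i = digit (Suc m) k i'" if k: "k \<noteq> e" "k \<noteq> t" for k
    proof (rule ccontr)
      assume "digit (Suc m) k i \<noteq> digit (Suc m) k i'"
      then have "1 \<le> \<bar>real (digit (Suc m) k i) - real (digit (Suc m) k i')\<bar>"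
        using mod_eq_imp_far[of "digit (Suc m) k i" 1 "digit (Suc m) k i'"] by simp
      then have "2 * r * 1 \<le> fn m s * \<bar>real (digit (Suc m) k i) - real (digit (Suc m) k i')\<bar>"
        using 2 r by (intro mult_mono) auto
      then show False using k2[OF k] by simp
    qed
    have "i mod J (Suc m) ^ (n - 2) = i' mod J (Suc m) ^ (n - 2)"
    proof (rule digits_eq_imp_mod_eq)
      fix q assume "q < n - 2"
      then have "q \<in> pos ` (UNIV - {e, t})" using pos by (simp add: bij_betw_def)
      then obtain k where "k \<noteq> e" "k \<noteq> t" "pos k = q" by auto
      then show "i div J (Suc m) ^ q mod J (Suc m) = i' div J (Suc m) ^ q mod J (Suc m)"
        using dig[of k] by (simp add: digit_def)
    qed
    \<comment> \<open>With \<open>N = J ^ (n - 1)\<close>, such a gap between the numbers puts the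
      sites at least \<open>1 / J\<close> apart.\<close>
    then have "?J ^ (n - 2) \<le> \<bar>real i - real i'\<bar>" using mod_eq_imp_far[OF _ ne] by fastforce
    then have "sp m s * (?J ^ (n - 2) / ?N) \<le> sp m s * (\<bar>real i - real i'\<bar> / ?N)"
      using sp0 p by (intro mult_left_mono divide_right_mono) auto
    also note e2
    also have "?J ^ (n - 2) / ?N = 1 / ?J"
    proof -
      have "n - 1 = Suc (n - 2)" using n3 by simp
      then have "?N = ?J * ?J ^ (n - 2)" by (simp add: N_def)
      then show ?thesis using p by simp
    qed
    finally have *: "sp m s / ?J < 2 * r" by simp
    \<comment> \<open>Since \<open>w * J * M = 1/2\<close>, even the widest channel fits into this
      gap; this dictates the value of \<open>M\<close>.\<close>
    have "2 * r \<le> 2 * (?M * sp m s * ?w)" using sgM p unfolding r_def by (intro mult_left_mono mult_right_mono) auto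
    also have "\<dots> = 2 * (?w * ?J * ?M) * sp m s / ?J" using p by simp
    also have "\<dots> = sp m s / ?J" by (simp add: w_J_M)
    finally show False using * by simp
  qed
qed

text \<open>The image height determines the stage and then the original height. At a fixed height
  the map is a similarity in a hub, and between hubs \<open>channels_disjoint\<close> identifies the
  channel.\<close>

lemma inj_G: "inj_on G Om"
proof (rule inj_onI)
  fix y y' assume y: "y \<in> Om" and y': "y' \<in> Om" and eq: "G y = G y'"
  obtain m where m: "b m \<le> y $ t" "y $ t < b (Suc m)" using stage_exists[OF y] by blast
  obtain m' where m': "b m' \<le> y' $ t" "y' $ t < b (Suc m')" using stage_exists[OF y'] by blast
  have h: "height m (y $ t) = height m' (y' $ t)"
    using G_stage[OF m] G_stage[OF m'] eq by simp
  \<comment> \<open>Different stages have disjoint, ordered ranges of image heights.\<close>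
  have ord: "height k s < height k' s'" if "k < k'" "b k \<le> s" "s < b (Suc k)" "b k' \<le> s'" for k k' s s'
  proof -
    have "height k s < height k (b (Suc k))" using that by (intro height_less) auto
    also have "\<dots> \<le> hb k'" using hb_mono[of "Suc k" k'] that by (simp add: height_base del: hb.simps(2) b.simps(2))
    also have "\<dots> \<le> height k' s'" using height_less[of k' "b k'" s'] that(4)
      by (cases "s' = b k'") (auto simp: height_base)
    finally show ?thesis .
  qed
  have "m = m'" using ord[OF _ m m'(1)] ord[OF _ m' m(1)] h by (metis less_irrefl linorder_neqE_nat)
  have hm: "height m (y $ t) = height m (y' $ t)" using h \<open>m = m'\<close> by simp
  have bm: "b m - 1 < y $ t" "b m - 1 < y' $ t" using m m' \<open>m = m'\<close> by auto
  have t: "y $ t = y' $ t"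
    using height_less[OF bm(1)] height_less[OF bm(2)] hm by (metis less_irrefl not_less_iff_gr_or_eq)
  show "y = y'"
  proof (cases "y $ t \<le> b m + 2 * w m")
    case True
    have st: "stage (y $ t) = m" "stage (y' $ t) = m" using stage_eq m m' \<open>m = m'\<close> by auto
    then have "hubmap m y = hubmap m y'" using eq True m(1) t by (simp add: G_def chmap_low)
    then have hub: "hubmap m y $ j = hubmap m y' $ j" for j by simp
    have "lam m * y $ j = lam m * y' $ j" for j
      using hub[of j] t by (cases "j = t") (simp_all add: hubmap_def)
    then have "y $ j = y' $ j" for j using lam_pos[of m] by (metis less_irrefl mult_cancel_left)
    then show ?thesis by (simp add: vec_eq_iff)
  next
    case False
    obtain i where i: "i \<le> N (Suc m)" "y \<in> channel m i" using hub_range[OF y, of m] False m by auto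
    obtain i' where i': "i' \<le> N (Suc m)" "y' \<in> channel m i'" using hub_range[OF y', of m] False m t by auto
    have ch: "chmap m i y = chmap m i' y'" using G_channel i i' eq by simp
    have "i = i'" by (rule channels_disjoint[OF i(2) i'(2) t ch])
    have "y $ j = y' $ j" for j
    proof (cases "j = t")
      case False
      have "chmap m i y $ j = chmap m i y' $ j" using ch \<open>i = i'\<close> by simp
      then show ?thesis using False t sg_pos[of m "y' $ t"] by (auto simp: chmap_def split: if_splits)
    qed (use t in simp)
    then show ?thesis by (simp add: vec_eq_iff)
  qed
qed

end


section \<open>Derivatives, absolute continuity and operator norms\<close>

lemma has_derivative_vecI:
  fixes f :: "'a::real_normed_vector \<Rightarrow> real^'n::finite"
  assumes "\<And>j. ((\<lambda>y. f y $ j) has_derivative (\<lambda>v. D v $ j)) (at x)"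
  shows "(f has_derivative D) (at x)"
  by (subst has_derivative_componentwise_within) (auto simp: Basis_vec_def inner_axis assms)

lemma has_derivative_vec_nth: "((\<lambda>x::real^'n::finite. x $ j) has_derivative (\<lambda>v. v $ j)) F"
  by (rule bounded_linear_imp_has_derivative[OF bounded_linear_vec_nth])

lemma Lipschitz_imp_abs_continuous:
  fixes h :: "real \<Rightarrow> 'a::euclidean_space"
  assumes h: "\<And>x y. x \<in> {a..b} \<Longrightarrow> y \<in> {a..b} \<Longrightarrow> dist (h x) (h y) \<le> B * \<bar>x - y\<bar>" and B: "0 \<le> B"
  shows "abs_continuous_on_interval h a b"
  unfolding abs_continuous_on_interval_def
proof (intro allI impI)
  fix \<epsilon> :: real assume \<epsilon>: "0 < \<epsilon>"
  show "\<exists>\<delta>>0. \<forall>\<D> S. \<D> division_of S \<and> S \<subseteq> {a..b} \<and> (\<Sum>I\<in>\<D>. Sup I - Inf I) < \<delta>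
        \<longrightarrow> (\<Sum>I\<in>\<D>. dist (h (Inf I)) (h (Sup I))) < \<epsilon>"
  \<comment> \<open>The summand 1 covers the case \<open>B = 0\<close>.\<close>
  proof (intro exI[of _ "\<epsilon> / (B + 1)"] conjI allI impI)
    show "0 < \<epsilon> / (B + 1)" using \<epsilon> B by simp
    fix \<D> S assume D: "\<D> division_of S \<and> S \<subseteq> {a..b} \<and> (\<Sum>I\<in>\<D>. Sup I - Inf I) < \<epsilon> / (B + 1)"
    have le: "0 \<le> Sup I - Inf I \<and> dist (h (Inf I)) (h (Sup I)) \<le> B * (Sup I - Inf I)" if I: "I \<in> \<D>" for I
    proof -
      obtain c d where cd: "I = cbox c d" "I \<noteq> {}" "I \<subseteq> {a..b}"
        using division_ofD(2,3,4)[of \<D> S I] D I by (metis subset_trans)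
      then have "I = {c..d}" "c \<le> d" "a \<le> c" "d \<le> b" by auto
      then show ?thesis using h[of c d] by simp
    qed
    have nn: "0 \<le> (\<Sum>I\<in>\<D>. Sup I - Inf I)" using le by (intro sum_nonneg) blast
    have "(\<Sum>I\<in>\<D>. dist (h (Inf I)) (h (Sup I))) \<le> (\<Sum>I\<in>\<D>. B * (Sup I - Inf I))"
      using le by (intro sum_mono) blast
    also have "\<dots> = B * (\<Sum>I\<in>\<D>. Sup I - Inf I)" by (simp add: sum_distrib_left)
    also have "\<dots> \<le> (B + 1) * (\<Sum>I\<in>\<D>. Sup I - Inf I)" using nn by (intro mult_right_mono) auto
    also have "\<dots> < (B + 1) * (\<epsilon> / (B + 1))" using D B by (intro mult_strict_left_mono) auto
    also have "\<dots> = \<epsilon>" using B by simp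
    finally show "(\<Sum>I\<in>\<D>. dist (h (Inf I)) (h (Sup I))) < \<epsilon>" .
  qed
qed

lemma onorm_scale_shear_le:
  fixes u :: "real^'n::finite"
  assumes "0 \<le> s" "norm u \<le> c * s"
  shows "onorm (\<lambda>v. s *\<^sub>R v + v $ k *\<^sub>R u) \<le> (1 + c) * s"
proof (rule onorm_le)
  fix v :: "real^'n"
  have "norm (s *\<^sub>R v + v $ k *\<^sub>R u) \<le> s * norm v + \<bar>v $ k\<bar> * norm u"
    using norm_triangle_ineq[of "s *\<^sub>R v" "v $ k *\<^sub>R u"] assms(1) by simp
  also have "\<dots> \<le> s * norm v + norm v * (c * s)"
    using component_le_norm_cart[of v k] assms by (intro add_left_mono mult_mono) auto
  finally show "norm (s *\<^sub>R v + v $ k *\<^sub>R u) \<le> (1 + c) * s * norm v" by (simp add: algebra_simps)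
qed

section \<open>Quasiconformality of the inverse map\<close>

context channels
begin

lemma hub_derivative: "(hubmap m has_derivative (\<lambda>v. lam m *\<^sub>R v)) (at y)"
proof (rule has_derivative_vecI)
  fix j
  show "((\<lambda>y. hubmap m y $ j) has_derivative (\<lambda>v. (lam m *\<^sub>R v) $ j)) (at y)"
    by (cases "j = t") (auto simp: hubmap_def intro!: derivative_eq_intros has_derivative_vec_nth)
qed

lemma height_component:
  assumes "(f has_real_derivative d) (at (y $ t))"
  shows "((\<lambda>y::real^'n. f (y $ t)) has_derivative (\<lambda>v. v $ t * d)) (at y)"
  by (rule DERIV_compose_FDERIV[where g = "\<lambda>y. y $ t", OF assms has_derivative_vec_nth])

text \<open>As \<open>height\<close> has derivative \<open>sg\<close>, the derivative is
  \<open>sg\<close> times the identity except in the column of \<open>t\<close>, where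
  \<open>u\<close> collects the height derivatives of \<open>sg\<close>, \<open>sp\<close> and
  \<open>fn\<close>. The constant 20 is 4 + 16; the factor \<open>n\<close> comes from bounding the
  norm by a sum over coordinates.\<close>

lemma channel_derivative:
  assumes y: "y \<in> channel m i" and i: "i \<le> N (Suc m)"
  obtains u where "(chmap m i has_derivative (\<lambda>v. sg m (y $ t) *\<^sub>R v + v $ t *\<^sub>R u)) (at y)"
    "u $ t = 0" "norm u \<le> 20 * real n * sg m (y $ t)"
proof -
  define s where "s = y $ t"
  have s: "b m - 1 < s" using y w_pos[of m] by (auto simp: channel_def al_def s_def)
  obtain d1 where d1: "(sg m has_real_derivative d1) (at s)" "\<bar>d1\<bar> * w (Suc m) \<le> 4 * sg m s"
    using sg_derivative by blast
  obtain d2 where d2: "(sp m has_real_derivative d2) (at s)" "\<bar>d2\<bar> \<le> 4 * sg m s"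
    using sp_derivative by blast
  obtain d3 where d3: "(fn m has_real_derivative d3) (at s)" "\<bar>d3\<bar> * real (J (Suc m)) \<le> 16 * sg m s"
    using fn_derivative by blast
  define u where "u = (\<chi> j. if j = t then 0 else if j = e then d1 * (y $ e - site (Suc m) i) + d2 * site (Suc m) i
     else d1 * y $ j + d3 * real (digit (Suc m) j i))"
  have "(chmap m i has_derivative (\<lambda>v. sg m s *\<^sub>R v + v $ t *\<^sub>R u)) (at y)"
  proof (rule has_derivative_vecI)
    fix j
    note h = height_component[OF DERIV_height[OF s, unfolded s_def]]
      height_component[OF d1(1)[unfolded s_def]] height_component[OF d2(1)[unfolded s_def]]
      height_component[OF d3(1)[unfolded s_def]]
    consider "j = t" | "j = e" | "j \<noteq> e" "j \<noteq> t" by blast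
    then show "((\<lambda>y. chmap m i y $ j) has_derivative (\<lambda>v. (sg m s *\<^sub>R v + v $ t *\<^sub>R u) $ j)) (at y)"
    proof cases
      case 1
      then show ?thesis using h(1) by (simp add: chmap_def u_def s_def mult.commute)
    next
      case 2
      have "((\<lambda>y. sg m (y $ t) * (y $ e - site (Suc m) i) + sp m (y $ t) * site (Suc m) i) has_derivative
         (\<lambda>v. sg m s * v $ e + v $ t * (d1 * (y $ e - site (Suc m) i) + d2 * site (Suc m) i))) (at y)"
        by (rule has_derivative_eq_rhs, (rule h has_derivative_vec_nth has_derivative_const has_derivative_add
              has_derivative_diff has_derivative_mult)+) (auto simp: s_def algebra_simps)
      then show ?thesis using 2 et by (simp add: chmap_def u_def)
    next
      case 3
      have "((\<lambda>y. sg m (y $ t) * y $ j + fn m (y $ t) * real (digit (Suc m) j i)) has_derivative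
         (\<lambda>v. sg m s * v $ j + v $ t * (d1 * y $ j + d3 * real (digit (Suc m) j i)))) (at y)"
        by (rule has_derivative_eq_rhs, (rule h has_derivative_vec_nth has_derivative_const has_derivative_add
              has_derivative_diff has_derivative_mult)+) (auto simp: s_def algebra_simps)
      then show ?thesis using 3 by (simp add: chmap_def u_def)
    qed
  qed
  moreover have "u $ t = 0" by (simp add: u_def)
  moreover have "norm u \<le> 20 * real n * sg m s"
  proof -
    have small: "\<bar>d1 * a\<bar> \<le> 4 * sg m s" if "\<bar>a\<bar> < w (Suc m)" for a
    proof -
      have "\<bar>d1 * a\<bar> \<le> \<bar>d1\<bar> * w (Suc m)" unfolding abs_mult using that by (intro mult_left_mono) auto
      then show ?thesis using d1(2) by simp
    qed
    have "\<bar>u $ j\<bar> \<le> 20 * sg m s" for j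
    proof -
      consider "j = t" | "j = e" | "j \<noteq> e" "j \<noteq> t" by blast
      then show ?thesis
      proof cases
        case 1
        then show ?thesis using sg_pos[of m s] by (simp add: u_def)
      next
        case 2
        have "\<bar>d1 * (y $ e - site (Suc m) i)\<bar> \<le> 4 * sg m s" using y by (intro small) (simp add: channel_def)
        moreover have "\<bar>d2 * site (Suc m) i\<bar> \<le> \<bar>d2\<bar> * 1"
          unfolding abs_mult using site_bounds[OF i] by (intro mult_left_mono) auto
        moreover have "u $ j = d1 * (y $ e - site (Suc m) i) + d2 * site (Suc m) i" using 2 et by (simp add: u_def)
        ultimately show ?thesis using d2(2) sg_pos[of m s] by linarith
      next
        case 3
        have "\<bar>d1 * y $ j\<bar> \<le> 4 * sg m s" using y 3 by (intro small) (simp add: channel_def)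
        moreover have "\<bar>d3 * real (digit (Suc m) j i)\<bar> \<le> \<bar>d3\<bar> * real (J (Suc m))"
          unfolding abs_mult using J_pos[of "Suc m"] by (intro mult_left_mono) (auto simp: digit_def less_imp_le)
        moreover have "u $ j = d1 * y $ j + d3 * real (digit (Suc m) j i)" using 3 by (simp add: u_def)
        ultimately show ?thesis using d3(2) by linarith
      qed
    qed
    then have "(\<Sum>j\<in>UNIV. \<bar>u $ j\<bar>) \<le> (\<Sum>j\<in>(UNIV::'n set). 20 * sg m s)" by (intro sum_mono)
    then show ?thesis using norm_le_l1_cart[of u] n_card by simp
  qed
  ultimately show thesis using that by (simp add: s_def)
qed

text \<open>The last clause bounds the scale from below at bounded levels; it yields local Lipschitz
  bounds for the inverse.\<close>

lemma G_derivative: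
  assumes "y \<in> Om"
  obtains \<sigma> u where "0 < \<sigma>" "(G has_derivative (\<lambda>v. \<sigma> *\<^sub>R v + v $ t *\<^sub>R u)) (at y)"
    "u $ t = 0" "norm u \<le> 20 * real n * \<sigma>" "\<And>k. y $ t < b k \<Longrightarrow> lam k \<le> \<sigma>"
  using assms
proof (cases rule: Om_cases)
  case (hub m)
  have "(G has_derivative (\<lambda>v. lam m *\<^sub>R v)) (at y)"
    by (rule has_derivative_transform_within_open[OF hub_derivative open_hub hub]) (simp add: G_hub)
  moreover have "lam k \<le> lam m" if "y $ t < b k" for k
  proof -
    have "b m < b k" using that hub by (simp add: hub_def)
    then have "m \<le> k" using b_mono[of k m] by linarith
    then show ?thesis by (rule lam_antimono)
  qed
  ultimately show thesis using that[of "lam m" 0] lam_pos[of m] by simp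
next
  case (channel m i)
  obtain u where u: "(chmap m i has_derivative (\<lambda>v. sg m (y $ t) *\<^sub>R v + v $ t *\<^sub>R u)) (at y)"
    "u $ t = 0" "norm u \<le> 20 * real n * sg m (y $ t)"
    using channel_derivative[OF channel(2,1)] .
  have "(G has_derivative (\<lambda>v. sg m (y $ t) *\<^sub>R v + v $ t *\<^sub>R u)) (at y)"
    by (rule has_derivative_transform_within_open[OF u(1) open_channel channel(2)]) (simp add: G_channel)
  moreover have "lam k \<le> sg m (y $ t)" if "y $ t < b k" for k
  proof -
    have "b m < b k" using that channel(2) w_pos[of m] by (simp add: channel_def al_def)
    then have "Suc m \<le> k" using b_mono[of k m] by (metis not_less_eq_eq not_le)
    then show ?thesis using lam_antimono sg_ge order_trans by blast
  qed
  ultimately show thesis using that[of "sg m (y $ t)" u] sg_pos[of m] u by blast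
qed

lemma continuous_G: "continuous_on Om G"
proof (intro continuous_at_imp_continuous_on ballI)
  fix y assume "y \<in> Om"
  then obtain D where "(G has_derivative D) (at y)" using G_derivative by blast
  then show "isCont G y" by (rule has_derivative_continuous)
qed

definition F :: "real^'n \<Rightarrow> real^'n" where "F = inv_into Om G"

lemma F_G: "y \<in> Om \<Longrightarrow> F (G y) = y"
  by (simp add: F_def inj_G)

lemma homeo: "homeomorphism (G ` Om) Om F G"
proof -
  have "continuous_on (G ` Om) F"
    by (rule continuous_on_inverse_open[OF open_Om continuous_G]) (simp_all add: F_G)
  then show ?thesis using continuous_G F_G unfolding homeomorphism_def by (auto simp: image_image)
qed

lemma domain_image: "is_domain (G ` Om)"
proof -
  have "open (G ` Om)" by (rule invariance_of_domain[OF continuous_G open_Om inj_G])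
  then show ?thesis using domain_Om connected_continuous_image[OF continuous_G]
    by (auto simp: is_domain_def)
qed

lemma F_derivative:
  assumes z: "z \<in> G ` Om"
  obtains r u where "0 < r" "(F has_derivative (\<lambda>v. r *\<^sub>R v + v $ t *\<^sub>R u)) (at z)"
    "u $ t = 0" "norm u \<le> 20 * real n * r" "\<forall>k. F z $ t < b k \<longrightarrow> r \<le> 1 / lam k"
proof -
  obtain y where y: "y \<in> Om" "z = G y" using z by blast
  obtain \<sigma> u where \<sigma>: "0 < \<sigma>" "(G has_derivative (\<lambda>v. \<sigma> *\<^sub>R v + v $ t *\<^sub>R u)) (at y)"
    "u $ t = 0" "norm u \<le> 20 * real n * \<sigma>" "\<And>k. y $ t < b k \<Longrightarrow> lam k \<le> \<sigma>"
    using G_derivative[OF y(1)] by blast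
  \<comment> \<open>As \<open>u $ t = 0\<close>, the shear part squares to zero, and the Neumann
    series of the inverse stops after two terms.\<close>
  define u' where "u' = (- 1 / \<sigma>\<^sup>2) *\<^sub>R u"
  have "(F has_derivative (\<lambda>v. (1 / \<sigma>) *\<^sub>R v + v $ t *\<^sub>R u')) (at (G y))"
  proof (rule has_derivative_inverse_strong[OF open_Om y(1) continuous_G F_G \<sigma>(2)])
    show "(\<lambda>v. \<sigma> *\<^sub>R v + v $ t *\<^sub>R u) \<circ> (\<lambda>v. (1 / \<sigma>) *\<^sub>R v + v $ t *\<^sub>R u') = id"
      using \<sigma>(1,3) by (auto simp: fun_eq_iff vec_eq_iff u'_def power2_eq_square field_simps)
  qed
  moreover have "norm u' \<le> 20 * real n * (1 / \<sigma>)"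
  proof -
    have "norm u' = norm u / \<sigma>\<^sup>2" by (simp add: u'_def)
    also have "\<dots> \<le> 20 * real n * \<sigma> / \<sigma>\<^sup>2" using \<sigma>(4) by (rule divide_right_mono) simp
    finally show ?thesis using \<sigma>(1) by (simp add: power2_eq_square)
  qed
  moreover have "1 / \<sigma> \<le> 1 / lam k" if "F z $ t < b k" for k
    using \<sigma>(5)[of k] that y lam_pos[of k] by (simp add: F_G frac_le)
  moreover have "u' $ t = 0" using \<sigma>(3) by (simp add: u'_def)
  ultimately show thesis using that[of "1 / \<sigma>" u'] \<sigma>(1) y(2) by simp
qed

text \<open>By compactness the height of \<open>F\<close> has a maximum on the box, which lies below
  some \<open>b (Suc m)\<close>. There the derivative of \<open>F\<close> is bounded, and the box is
  convex.\<close>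

lemma F_Lipschitz_box:
  assumes box: "cbox a c \<subseteq> G ` Om"
  shows "\<exists>B\<ge>0. \<forall>x\<in>cbox a c. \<forall>y\<in>cbox a c. dist (F x) (F y) \<le> B * dist x y"
proof (cases "cbox a c = {}")
  case False
  have cF: "continuous_on (cbox a c) F"
    using homeo box by (auto simp: homeomorphism_def intro: continuous_on_subset)
  have "continuous_on (cbox a c) (\<lambda>x. F x $ t)" by (intro continuous_intros cF)
  then obtain x0 where x0: "x0 \<in> cbox a c" "\<And>x. x \<in> cbox a c \<Longrightarrow> F x $ t \<le> F x0 $ t"
    using continuous_attains_sup[OF compact_cbox False] by blast
  have "F x0 \<in> Om" using x0(1) box homeo by (auto simp: homeomorphism_def)
  then obtain m where m: "F x0 $ t < b (Suc m)" using stage_exists by blast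
  define B where "B = (1 + 20 * real n) * (1 / lam (Suc m))"
  have D: "\<exists>D. (F has_derivative D) (at x within cbox a c) \<and> onorm D \<le> B" if x: "x \<in> cbox a c" for x
  proof -
    have "x \<in> G ` Om" using x box by blast
    then obtain r u where r: "0 < r" "(F has_derivative (\<lambda>v. r *\<^sub>R v + v $ t *\<^sub>R u)) (at x)"
      "u $ t = 0" "norm u \<le> 20 * real n * r" "\<forall>k. F x $ t < b k \<longrightarrow> r \<le> 1 / lam k"
      by (rule F_derivative)
    have "F x $ t < b (Suc m)" using x0(2)[OF x] m by simp
    then have "(1 + 20 * real n) * r \<le> B" unfolding B_def using r(5) by (intro mult_left_mono) auto
    then have "onorm (\<lambda>v. r *\<^sub>R v + v $ t *\<^sub>R u) \<le> B"
      using onorm_scale_shear_le[of r u "20 * real n" t] r(1,4) by simp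
    then show ?thesis using has_derivative_at_withinI[OF r(2)] by blast
  qed
  then have "\<forall>x\<in>cbox a c. \<exists>D. (F has_derivative D) (at x within cbox a c) \<and> onorm D \<le> B" by blast
  from bchoice[OF this] obtain D where "\<forall>x\<in>cbox a c. (F has_derivative D x) (at x within cbox a c) \<and> onorm (D x) \<le> B" ..
  then have D: "\<And>x. x \<in> cbox a c \<Longrightarrow> (F has_derivative D x) (at x within cbox a c)"
    "\<And>x. x \<in> cbox a c \<Longrightarrow> onorm (D x) \<le> B" by auto
  have "dist (F x) (F y) \<le> B * dist x y" if "x \<in> cbox a c" "y \<in> cbox a c" for x y
    unfolding dist_norm by (rule differentiable_bound[OF convex_box(1) D that])
  moreover have "0 \<le> B" using lam_pos[of "Suc m"] by (simp add: B_def)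
  ultimately show ?thesis by blast
qed auto

lemma F_ACL: "ACL_on (G ` Om) F"
  unfolding ACL_on_def
proof (intro conjI allI impI AE_I2)
  show "continuous_on (G ` Om) F" using homeo by (simp add: homeomorphism_def)
  fix a c :: "real^'n" and i x
  assume box: "cbox a c \<subseteq> G ` Om" and x: "x \<in> cbox a c"
  obtain B where B: "0 \<le> B" "\<And>x y. x \<in> cbox a c \<Longrightarrow> y \<in> cbox a c \<Longrightarrow> dist (F x) (F y) \<le> B * dist x y"
    using F_Lipschitz_box[OF box] by blast
  define p where "p = (\<lambda>\<tau>. \<chi> j. if j = i then \<tau> else x $ j)"
  have p: "p \<tau> \<in> cbox a c" if "\<tau> \<in> {a $ i..c $ i}" for \<tau>
    using x that by (auto simp: p_def mem_box_cart)
  have "dist (p \<tau>) (p \<tau>') = \<bar>\<tau> - \<tau>'\<bar>" for \<tau> \<tau>'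
  proof -
    have "p \<tau> - p \<tau>' = axis i (\<tau> - \<tau>')" by (auto simp: p_def axis_def vec_eq_iff)
    then show ?thesis by (simp add: dist_norm norm_axis)
  qed
  then have "abs_continuous_on_interval (\<lambda>\<tau>. F (p \<tau>)) (a $ i) (c $ i)"
    using B p by (intro Lipschitz_imp_abs_continuous[where B = B]) metis+
  then show "abs_continuous_on_interval (\<lambda>\<tau>. F (\<chi> j. if j = i then \<tau> else x $ j)) (a $ i) (c $ i)"
    by (simp add: p_def)
qed

lemma F_quasiconformal: "quasiconformal (G ` Om) Om F"
  unfolding quasiconformal_def K_quasiconformal_def
\<comment> \<open>The operator norm is at most \<open>(1 + 20 * n) * r\<close>, whereas the
  determinant is \<open>r ^ n\<close>.\<close>
proof (intro exI[of _ "(1 + 20 * real n) ^ n"] conjI AE_I2 impI domain_image domain_Om F_ACL)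
  show "1 \<le> (1 + 20 * real n) ^ n" by (intro one_le_power) simp
  show "\<exists>g. homeomorphism (G ` Om) Om F g" using homeo by blast
  fix z assume "z \<in> G ` Om"
  then obtain r u where r: "0 < r" "(F has_derivative (\<lambda>v. r *\<^sub>R v + v $ t *\<^sub>R u)) (at z)"
    "u $ t = 0" "norm u \<le> 20 * real n * r" "\<forall>k. F z $ t < b k \<longrightarrow> r \<le> 1 / lam k"
    by (rule F_derivative)
  let ?D = "\<lambda>v. r *\<^sub>R v + v $ t *\<^sub>R u"
  have "bounded_linear ?D" using r(2) by (rule has_derivative_bounded_linear)
  then have "onorm ?D ^ CARD('n) \<le> ((1 + 20 * real n) * r) ^ CARD('n)"
    using onorm_scale_shear_le[of r u "20 * real n" t] r(1,4) by (intro power_mono onorm_pos_le) auto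
  also have "\<dots> = (1 + 20 * real n) ^ n * \<bar>det (matrix ?D)\<bar>"
    using r(1) by (simp add: det_scale_shear[of u t, OF r(3)] power_mult_distrib n_card)
  finally show "\<exists>D. (F has_derivative D) (at z) \<and> onorm D ^ CARD('n) \<le> (1 + 20 * real n) ^ n * \<bar>det (matrix D)\<bar>"
    using r(2) by blast
qed

text \<open>\<open>G\<close> maps the axis of hub \<open>m\<close> onto a segment of length
  \<open>lam m\<close>, which tends to 0, while the end points of the axis are at distance
  1.\<close>

lemma F_not_internally_uniformly_continuous: "\<not> internally_uniformly_continuous (G ` Om) F"
proof
  assume "internally_uniformly_continuous (G ` Om) F"
  then obtain \<delta> where \<delta>: "0 < \<delta>"
    "\<And>z z'. z \<in> G ` Om \<Longrightarrow> z' \<in> G ` Om \<Longrightarrow> internal_dist (G ` Om) z z' < ennreal \<delta> \<Longrightarrow> dist (F z) (F z') < 1"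
    unfolding internally_uniformly_continuous_def by (metis zero_less_one)
  obtain m where m: "lam m < \<delta>" unfolding lam_def using real_arch_pow_inv[OF \<delta>(1), of "1/2"] by auto
  have hub: "pt v (al m) \<in> hub m" if "0 \<le> v" "v \<le> 1" for v
  proof -
    have "pt v (al m) \<in> cube (pt v (al m)) (w m)" using w_pos[of m] by (simp add: cube_def)
    then show ?thesis using cube_hub[OF that] by blast
  qed
  define z where "z = (\<lambda>v. G (pt v (al m)))"
  have z_in: "z v \<in> G ` Om" if "0 \<le> v" "v \<le> 1" for v
    using hub[OF that] hub_subset by (auto simp: z_def)
  have zv: "z v = z 0 + (v * lam m) *\<^sub>R axis e 1" if "0 \<le> v" "v \<le> 1" for v
    using hub[OF that] hub[of 0] et
    by (auto simp: z_def G_hub hubmap_def vec_eq_iff axis_def pt_def)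
  have dz: "dist (z 0) (z 1) = lam m"
    using zv[of 1] lam_pos[of m] by (simp add: dist_norm)
  define g where "g = linepath (z 0) (z 1)"
  have "path_image g \<subseteq> G ` Om"
  proof
    fix p assume "p \<in> path_image g"
    then obtain v where v: "0 \<le> v" "v \<le> 1" "p = (1 - v) *\<^sub>R z 0 + v *\<^sub>R z 1"
      by (auto simp: g_def closed_segment_def)
    have "p = z v" unfolding v(3) zv[OF v(1,2)] using zv[of 1] by (simp add: algebra_simps)
    then show "p \<in> G ` Om" using z_in v by simp
  qed
  moreover have "path_length g \<le> ennreal (lam m * (1 - 0))"
    unfolding path_length_def
  proof (rule curve_length_Lipschitz)
    fix x y :: real assume "x \<le> y"
    have "g x - g y = (y - x) *\<^sub>R (z 0 - z 1)" by (simp add: g_def linepath_def algebra_simps)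
    then have "dist (g x) (g y) = (y - x) * dist (z 0) (z 1)" using \<open>x \<le> y\<close> by (simp add: dist_norm)
    then show "dist (g x) (g y) \<le> lam m * (y - x)" using dz by simp
  qed (use lam_pos[of m] in auto)
  moreover have "internal_dist (G ` Om) (z 0) (z 1) \<le> path_length g"
    unfolding internal_dist_def using calculation(1) by (intro INF_lower) (auto simp: g_def)
  ultimately have "internal_dist (G ` Om) (z 0) (z 1) \<le> ennreal (lam m)" by simp
  also have "\<dots> < ennreal \<delta>" using m lam_pos[of m] by (simp add: ennreal_less_iff)
  finally have "dist (F (z 0)) (F (z 1)) < 1" using \<delta>(2) z_in by simp
  moreover have "F (z v) = pt v (al m)" if "0 \<le> v" "v \<le> 1" for v
    unfolding z_def using hub[OF that] hub_subset F_G by blast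
  ultimately show False by (simp add: dist_pt_e)
qed

end

theorem corollary1p5:
  assumes "CARD('n::finite) \<ge> 3"
  shows "\<exists>(\<Omega> :: (real^'n) set) x0 C.
    is_domain \<Omega> \<and> bounded \<Omega> \<and> x0 \<in> \<Omega> \<and> C > 0 \<and>
    (\<forall>x\<in>\<Omega>. enn2ereal (quasihyperbolic_dist \<Omega> x x0)
        \<le> ereal (C * bdist \<Omega> x powr (- (1 / real CARD('n))) * ln (C / bdist \<Omega> x))) \<and>
    (\<exists>(\<Omega>' :: (real^'n) set) f. is_domain \<Omega>' \<and> quasiconformal \<Omega>' \<Omega> f \<and>
        \<not> internally_uniformly_continuous \<Omega>' f)"
proof -
  \<comment> \<open>Two distinct coordinates are chosen as \<open>e\<close> and \<open>t\<close>;
    the remaining ones are numbered by \<open>pos\<close>.\<close>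
  have "2 \<le> card (UNIV :: 'n set)" using assms by simp
  then obtain T :: "'n set" where "card T = 2" by (rule obtain_subset_with_card_n)
  then obtain e t :: 'n where et: "e \<noteq> t" by (auto simp: card_2_iff)
  then have "card (UNIV - {e, t}) = CARD('n) - 2" by (simp add: card_Diff_subset)
  then obtain pos where "bij_betw pos (UNIV - {e, t}) {..<CARD('n) - 2}"
    using ex_bij_betw_finite_nat[of "UNIV - {e, t}"] by (auto simp: atLeast0LessThan)
  then interpret channels "CARD('n)" e t pos
    using assms et by unfold_locales auto
  show ?thesis
    by (rule exI[of _ Om], rule exI[of _ "pt 0 (al 0)"], rule exI[of _ C],
        intro conjI ballI exI[of _ "G ` Om"] exI[of _ F])
       (fact domain_Om bounded_Om base_in_Om C_pos domain_image F_quasiconformal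
          F_not_internally_uniformly_continuous | erule quasihyperbolic_growth)+
qed

end
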